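(* Let $P\in\mathbb{Z}[X]$ be a nonconstant irreducible polynomial of degree $d=\deg P$, and let $\delta=\gcd_{k\ge 0}P(k)$ be the greatest common divisor of all the integers $P(k)$, $k\in\mathbb{Z}_{\ge 0}$. Let $G$ be the Galois group of $P$ over $\mathbb{Q}$, viewed as a subgroup of $S_d$ via its action on the $d$ roots of $P$, and let $q$ be the proportion of elements of $G$ that fix a given root of $P$. Then there exists a constant $c>0$ such that for every $\varepsilon>0$ there exists $n(\varepsilon)$ such that for all integers $n\ge 2$ with $n>n(\varepsilon)$ and $\gcd(n,\delta)=1$, at least $$c\,n\,(\log\log n)^{-qd-\varepsilon}$$ of the numbers $P(0),P(1),P(2),\dots,P(n-1)$ are relatively prime to $n$. That is, $\varphi_P(n)\ge c\,n\,(\log\log n)^{-qd-\varepsilon}$, where $\varphi_P(n)=\#\{k\in\{0,1,\dots,n-1\}:\gcd(P(k),n)=1\}$. The constant $c$ does not depend on $\varepsilon$ or $n$.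
   Context: The Galois group of $P$ over $\mathbb{Q}$ is $\mathrm{Gal}(K/\mathbb{Q})$, where $K$ is the splitting field of $P$ over $\mathbb{Q}$. The proportion $q$ is $|\{\sigma\in G:\sigma(y)=y\}|/|G|$ for a root $y$ of $P$; since $P$ is irreducible, $G$ acts transitively on the roots, so this value does not depend on the choice of $y$. The numbers among $P(0),\dots,P(n-1)$ coprime to $n$ are counted by index, i.e. with repetition if the same value occurs for several $k$. Here $\log$ is the natural logarithm. *)

theory Defs
  imports
    Complex_Main
    "HOL-Algebra.Algebraic_Closure_Type"
    "HOL-Algebra.Generated_Fields"
    "HOL-Algebra.Bij"
    "HOL-Computational_Algebra.Polynomial_Factorial"
begin

definition complex_roots :: "int poly \<Rightarrow> complex set" where
  "complex_roots P = {z. poly (map_poly of_int P) z = 0}"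

text \<open>
  The splitting field of \<open>P\<close> over the rationals is taken inside the complex numbers: it is
  the subfield generated by the complex roots of \<open>P\<close>. It contains the rationals because
  every subfield of the complex numbers does.
\<close>

definition splitting_field :: "int poly \<Rightarrow> complex ring" where
  "splitting_field P = (ring_of_type_algebra :: complex ring)
     \<lparr>carrier := generate_field (ring_of_type_algebra :: complex ring) (complex_roots P)\<rparr>"

text \<open>
  The automorphisms of the splitting field that fix the rationals. As in \<^const>\<open>BijGroup\<close>,
  automorphisms are represented by extensional functions (undefined outside the field), so that
  each automorphism is counted exactly once.
\<close>

definition galois_group :: "int poly \<Rightarrow> (complex \<Rightarrow> complex) monoid" where
  "galois_group P = (BijGroup (carrier (splitting_field P)))
     \<lparr>carrier := {\<sigma> \<in> Bij (carrier (splitting_field P)).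
         \<sigma> \<in> ring_iso (splitting_field P) (splitting_field P) \<and> (\<forall>a\<in>\<rat>. \<sigma> a = a)}\<rparr>"

definition fix_proportion :: "int poly \<Rightarrow> complex \<Rightarrow> real" where
  "fix_proportion P y =
     real (card {\<sigma> \<in> carrier (galois_group P). \<sigma> y = y}) / real (card (carrier (galois_group P)))"

definition value_gcd :: "int poly \<Rightarrow> int" where
  "value_gcd P = Gcd (range (\<lambda>k::nat. poly P (int k)))"

definition phi :: "int poly \<Rightarrow> nat \<Rightarrow> nat" where
  "phi P n = card {k \<in> {0..<n}. gcd (poly P (int k)) (int n) = 1}"

end

theory Submission
  imports Defs "Subresultants.Subresultant_Gcd" "HOL-Number_Theory.Cong"
begin

text \<open>
  Let \<open>w(p)\<close> be the number of roots of \<open>P\<close> modulo \<open>p\<close>, so that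
  \<open>phi P n = n * (\<Prod>p dvd n. 1 - w(p)/p)\<close>. As the orbit of \<open>y\<close> has at most \<open>d\<close> elements,
  \<open>q * d \<ge> 1\<close>, and it suffices to prove \<open>phi P n \<ge> c * n / ln (ln n)\<close>. Primes above \<open>ln n\<close>
  contribute a bounded amount to \<open>\<Sum>p dvd n. w(p)/p\<close>, so this comes down to the upper half of the
  prime ideal theorem in Mertens' form, \<open>\<Sum>p\<le>x. w(p)/p \<le> ln (ln x) + O(1)\<close>, or, before partial
  summation, \<open>\<Sum>p\<le>x. w(p) * ln p / p \<le> ln x + O(1)\<close>.

  For the latter take \<open>x = B^d\<close> and consider all pairs of polynomials of degree below \<open>d\<close> with
  coefficients in \<open>{0..<B}\<close>. If \<open>Q \<noteq> 0\<close> is the difference of such a pair, the resultant of \<open>P\<close> and \<open>Q\<close>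
  is a nonzero integer of size \<open>O(B^d)\<close>, divisible by \<open>p\<close> to the number of common roots of \<open>P\<close> and
  \<open>Q\<close> modulo \<open>p\<close>. For each root of \<open>P\<close> modulo \<open>p\<close>, at least \<open>x\<^sup>2 / p - x\<close> of the pairs produce a \<open>Q\<close>
  with that root. Summing logarithms over all pairs, and using Chebyshev's bound for the error term,
  gives the estimate.
\<close>

subsection \<open>Common roots modulo a prime and the resultant\<close>

text \<open>Newton's interpolation basis for the nodes \<open>r 0\<close>, \<open>r 1\<close>, ...:
  its members are monic and vanish at successively more nodes, so expansions in it exist over the
  integers.\<close>

definition newton_poly :: "(nat \<Rightarrow> int) \<Rightarrow> nat \<Rightarrow> int poly" where
  "newton_poly r l = (\<Prod>j<l. [:- r j, 1:])"

lemma newton_poly_0 [simp]: "newton_poly r 0 = 1"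
  and newton_poly_Suc: "newton_poly r (Suc l) = newton_poly r l * [:- r l, 1:]"
  by (simp_all add: newton_poly_def)

lemma newton_poly_monic:
  "Polynomial.degree (newton_poly r l) = l \<and> Polynomial.coeff (newton_poly r l) l = 1"
proof (induction l)
  case (Suc l)
  then have nz: "newton_poly r l \<noteq> 0" by auto
  have deg: "Polynomial.degree (newton_poly r (Suc l)) = Suc l"
    unfolding newton_poly_Suc using Suc nz by (subst degree_mult_eq) auto
  moreover have "lead_coeff (newton_poly r (Suc l)) = 1"
    unfolding newton_poly_Suc lead_coeff_mult using Suc by auto
  ultimately show ?case by simp
qed auto

text \<open>Each basis element is monic of degree \<open>l\<close>, so the top coefficient can be
  stripped off without division. Bounding the support of the coefficients instead of the degree lets
  the induction start at \<open>N = 0\<close> with \<open>f = 0\<close>.\<close>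

lemma newton_poly_expansion:
  assumes "\<And>i. i \<ge> N \<Longrightarrow> Polynomial.coeff f i = 0"
  shows "\<exists>c. f = (\<Sum>l<N. Polynomial.smult (c l) (newton_poly r l))"
  using assms
proof (induction N arbitrary: f)
  case 0
  then show ?case by (auto intro: poly_eqI)
next
  case (Suc M)
  define g where "g = f - Polynomial.smult (Polynomial.coeff f M) (newton_poly r M)"
  have "Polynomial.coeff g i = 0" if "i \<ge> M" for i
  proof (cases "i = M")
    case True
    then show ?thesis using newton_poly_monic[of r M] by (simp add: g_def)
  next
    case False
    then show ?thesis
      using newton_poly_monic[of r M] that Suc.prems[of i] coeff_eq_0[of "newton_poly r M" i]
      by (simp add: g_def)
  qed
  from Suc.IH[OF this] obtain c where c: "g = (\<Sum>l<M. Polynomial.smult (c l) (newton_poly r l))"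
    by blast
  have "f = (\<Sum>l<Suc M. Polynomial.smult ((c(M := Polynomial.coeff f M)) l) (newton_poly r l))"
    using c by (simp add: g_def algebra_simps)
  then show ?case by blast
qed

text \<open>Evaluation at \<open>r l\<close> kills all terms beyond \<open>l\<close>, and by
  induction the earlier ones are divisible by \<open>p\<close>. What remains is \<open>c l\<close>
  times a product of differences of nodes, none of which \<open>p\<close> divides.\<close>

lemma prime_dvd_newton_coeffs:
  fixes p :: int
  assumes p: "prime p" and kN: "k \<le> N"
    and inj: "\<And>i j. i < j \<Longrightarrow> j < k \<Longrightarrow> \<not> p dvd r j - r i"
    and root: "\<And>j. j < k \<Longrightarrow> p dvd poly (\<Sum>l<N. Polynomial.smult (c l) (newton_poly r l)) (r j)"
    and l: "l < k"
  shows "p dvd c l"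
  using l
proof (induction l rule: less_induct)
  case (less l)
  let ?t = "\<lambda>m. c m * (\<Prod>j<m. r l - r j)"
  have "poly (\<Sum>m<N. Polynomial.smult (c m) (newton_poly r m)) (r l) = (\<Sum>m<N. ?t m)"
    by (simp add: poly_sum newton_poly_def poly_prod)
  also have "\<dots> = ?t l + (\<Sum>m\<in>{..<N}-{l}. ?t m)"
    using less.prems kN by (intro sum.remove) auto
  finally have eq: "poly (\<Sum>m<N. Polynomial.smult (c m) (newton_poly r m)) (r l)
      = ?t l + (\<Sum>m\<in>{..<N}-{l}. ?t m)" .
  have "p dvd ?t m" if "m \<in> {..<N}-{l}" for m
  proof (cases "m < l")
    case True
    then show ?thesis using less.IH[of m] less.prems by simp
  next
    case False
    then have "l < m" using that by auto
    then have "(\<Prod>j<m. r l - r j) = 0" by (intro prod_zero) auto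
    then show ?thesis by (simp only: mult_zero_right dvd_0_right)
  qed
  then have "p dvd (\<Sum>m\<in>{..<N}-{l}. ?t m)" by (rule dvd_sum)
  then have "p dvd ?t l"
    using root[OF less.prems] unfolding eq by (simp add: dvd_add_left_iff)
  moreover have "\<not> p dvd (\<Prod>j<l. r l - r j)"
    using inj less.prems p by (subst prime_dvd_prod_iff) auto
  ultimately show ?case using p prime_dvd_multD by blast
qed

text \<open>
  The rows of the Sylvester matrix are polynomials that vanish modulo \<open>p\<close> at every \<open>r j\<close>; in the Newton
  basis, which is a unimodular change of coordinates, their first \<open>k\<close> coefficients are divisible by \<open>p\<close>.
\<close>

lemma prime_power_dvd_resultant:
  fixes P Q :: "int poly" and p :: int
  assumes p: "prime p" and k: "k \<le> Polynomial.degree P + Polynomial.degree Q"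
    and inj: "\<And>i j. i < j \<Longrightarrow> j < k \<Longrightarrow> \<not> p dvd r j - r i"
    and rootP: "\<And>j. j < k \<Longrightarrow> p dvd poly P (r j)"
    and rootQ: "\<And>j. j < k \<Longrightarrow> p dvd poly Q (r j)"
  shows "p ^ k dvd resultant P Q"
proof -
  define n where "n = Polynomial.degree Q"
  define N where "N = Polynomial.degree P + n"
  have kN: "k \<le> N" using k by (simp add: N_def n_def)
  \<comment> \<open>The \<open>i\<close>-th row of the Sylvester matrix read as a polynomial: shifts
    of \<open>P\<close> in the first \<open>n\<close> rows, shifts of \<open>Q\<close> in the
    others.\<close>
  define F where "F i = (if i < n then Polynomial.monom 1 (n - i - 1) * P
                         else Polynomial.monom 1 (N - i - 1) * Q)" for i
  have F0: "Polynomial.coeff (F i) j = 0" if "j \<ge> N" "i < N" for i j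
    using that by (auto simp: F_def coeff_monom_mult N_def n_def intro!: coeff_eq_0)
  have "\<exists>c. F i = (\<Sum>l<N. Polynomial.smult (c l) (newton_poly r l))" if "i < N" for i
    using F0 that by (intro newton_poly_expansion)
  then obtain c where c: "\<And>i. i < N \<Longrightarrow> F i = (\<Sum>l<N. Polynomial.smult (c i l) (newton_poly r l))"
    using bchoice[of "{..<N}" "\<lambda>i c. F i = (\<Sum>l<N. Polynomial.smult (c l) (newton_poly r l))"]
    by auto
  define M where "M = mat N N (\<lambda>(i,l). c i l)"
  \<comment> \<open>Row \<open>l\<close> of \<open>T\<close> lists the coefficients of
    \<open>newton_poly r l\<close> from the highest power down, the column order of the Sylvester
    matrix.\<close>
  define T where "T = mat N N (\<lambda>(l,j). Polynomial.coeff (newton_poly r l) (N - 1 - j))"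
  have "sylvester_mat P Q = M * T"
  proof (rule eq_matI)
    fix i j assume ij: "i < dim_row (M * T)" "j < dim_col (M * T)"
    then have ij': "i < N" "j < N" by (auto simp: M_def T_def)
    have "sylvester_mat P Q $$ (i,j) = Polynomial.coeff (F i) (N - 1 - j)"
    proof -
      \<comment> \<open>The entry formula \<open>sylvester_index_mat2\<close> has monomial exponent
        and coefficient index both one larger than in \<open>F\<close>; lowering both together
        changes nothing.\<close>
      have shift: "Polynomial.coeff (Polynomial.monom 1 a * R) b =
          Polynomial.coeff (Polynomial.monom 1 (a - 1) * R) (b - 1)"
        if "0 < a" "0 < b" for a b and R :: "int poly"
        using that by (cases a; cases b) (simp_all add: coeff_monom_mult)
      show ?thesis
        using ij' sylvester_index_mat2[of i P Q j] shift[of "n - i" "N - j" P] shift[of "N - i" "N - j" Q]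
        unfolding F_def N_def n_def by simp
    qed
    also have "\<dots> = (\<Sum>l<N. c i l * Polynomial.coeff (newton_poly r l) (N - 1 - j))"
      by (simp only: c[OF ij'(1)] coeff_sum coeff_smult)
    also have "\<dots> = (M * T) $$ (i,j)"
      using ij' by (simp add: M_def T_def scalar_prod_def atLeast0LessThan)
    finally show "sylvester_mat P Q $$ (i,j) = (M * T) $$ (i,j)" .
  qed (auto simp: M_def T_def N_def n_def)
  then have res: "resultant P Q = det M * det T"
    unfolding resultant_def by (simp add: det_mult[of _ N] M_def T_def)
  have pc: "p dvd c i l" if "i < N" "l < k" for i l
  proof (rule prime_dvd_newton_coeffs[OF p kN inj])
    fix j assume "j < k"
    then show "p dvd poly (\<Sum>l<N. Polynomial.smult (c i l) (newton_poly r l)) (r j)"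
      using rootP rootQ unfolding c[OF that(1), symmetric] by (auto simp: F_def)
  qed (use that in auto)
  \<comment> \<open>The divisible entries of \<open>M\<close> fill its first \<open>k\<close>
    columns. After transposition, every Leibniz term takes one factor from each of them, namely
    those with index \<open>i < k\<close>.\<close>
  have "p ^ k dvd (\<Prod>i = 0..<N. transpose_mat M $$ (i, \<sigma> i))" if "\<sigma> permutes {0..<N}" for \<sigma>
  proof -
    have \<sigma>: "\<sigma> i < N" if "i < N" for i
      using permutes_in_image[OF \<open>\<sigma> permutes {0..<N}\<close>] that by auto
    have "p ^ k = (\<Prod>i = 0..<k. p)" by simp
    also have "\<dots> dvd (\<Prod>i = 0..<k. transpose_mat M $$ (i, \<sigma> i))"
      using kN \<sigma> pc by (intro prod_dvd_prod) (auto simp: M_def)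
    also have "\<dots> dvd (\<Prod>i = 0..<N. transpose_mat M $$ (i, \<sigma> i))"
      using kN by (intro prod_dvd_prod_subset) auto
    finally show ?thesis .
  qed
  then have "p ^ k dvd det (transpose_mat M)"
    unfolding det_def by (auto simp: M_def intro!: dvd_sum)
  then show ?thesis by (simp add: res det_transpose[of _ N] M_def)
qed

section \<open>Size and non-vanishing of the resultant\<close>

text \<open>Each Leibniz term has one factor from each of the \<open>degree Q\<close> rows of
  \<open>P\<close> and the \<open>degree P\<close> rows of \<open>Q\<close>. Hence \<open>B\<close>
  enters with exponent exactly \<open>degree P\<close>, which is what matches it to the number of
  polynomials in the box.\<close>

lemma abs_resultant_le:
  fixes P Q :: "int poly"
  assumes H: "\<And>i. \<bar>Polynomial.coeff P i\<bar> \<le> H" "1 \<le> H"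
    and B: "\<And>i. \<bar>Polynomial.coeff Q i\<bar> \<le> B"
    and deg: "Polynomial.degree Q \<le> Polynomial.degree P"
  shows "\<bar>resultant P Q\<bar> \<le>
    fact (2 * Polynomial.degree P) * H ^ Polynomial.degree P * B ^ Polynomial.degree P"
proof -
  define d where "d = Polynomial.degree P"
  define n where "n = Polynomial.degree Q"
  define S where "S = sylvester_mat P Q"
  have B0: "0 \<le> B" using B[of 0] by linarith
  have S: "dim_row S = d + n" "dim_col S = d + n" by (auto simp: S_def d_def n_def)
  have bd: "\<bar>S $$ (i,j)\<bar> \<le> (if i < n then H else B)" if "i < d + n" "j < d + n" for i j
    using that H B B0 unfolding S_def by (subst sylvester_index_mat) (auto simp: d_def n_def)
  have "\<bar>det S\<bar> \<le> (\<Sum>\<sigma> | \<sigma> permutes {0..<d+n}. \<bar>signof \<sigma> * (\<Prod>i = 0..<d+n. S $$ (i, \<sigma> i))\<bar>)"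
    unfolding det_def S by simp
  also have "\<dots> \<le> (\<Sum>\<sigma> | \<sigma> permutes {0..<d+n}. H ^ n * B ^ d)"
  proof (rule sum_mono, clarify)
    fix \<sigma> assume \<sigma>: "\<sigma> permutes {0..<d+n}"
    have "\<bar>signof \<sigma> * (\<Prod>i = 0..<d+n. S $$ (i, \<sigma> i))\<bar> = (\<Prod>i = 0..<d+n. \<bar>S $$ (i, \<sigma> i)\<bar>)"
      by (simp add: abs_mult abs_prod sign_def)
    also have "\<dots> \<le> (\<Prod>i = 0..<d+n. if i < n then H else B)"
      using permutes_in_image[OF \<sigma>] bd by (intro prod_mono) auto
    also have "\<dots> = (\<Prod>i \<in> {0..<n} \<union> {n..<d+n}. if i < n then H else B)"
      by (rule prod.cong) auto
    also have "\<dots> = H ^ n * B ^ d"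
      by (subst prod.union_disjoint) auto
    finally show "\<bar>signof \<sigma> * (\<Prod>i = 0..<d+n. S $$ (i, \<sigma> i))\<bar> \<le> H ^ n * B ^ d" .
  qed
  also have "\<dots> = fact (d + n) * (H ^ n * B ^ d)"
    by (simp add: card_permutations[of _ "d+n"])
  also have "\<dots> \<le> fact (2 * d) * (H ^ d * B ^ d)"
    using H(2) B0 deg
    by (intro mult_mono fact_mono power_increasing order.refl[of "B ^ d"]) (auto simp: d_def n_def)
  finally show ?thesis by (simp add: resultant_def S_def d_def mult.assoc)
qed

text \<open>A vanishing resultant means a common factor of positive degree; by irreducibility
  \<open>P\<close> divides it, hence divides \<open>Q\<close>, against the degrees.\<close>

lemma resultant_nonzero:
  fixes P Q :: "int poly"
  assumes "Factorial_Ring.irreducible P" "Q \<noteq> 0" "Polynomial.degree Q < Polynomial.degree P"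
  shows "resultant P Q \<noteq> 0"
proof
  assume "resultant P Q = 0"
  then have deg: "Polynomial.degree (gcd P Q) \<noteq> 0" unfolding resultant_0_gcd .
  have "\<forall>b. b dvd P \<longrightarrow> P dvd b \<or> is_unit b"
    using assms(1) unfolding irreducible_altdef by (elim conjE)
  then have "P dvd gcd P Q \<or> is_unit (gcd P Q)" using gcd_dvd1[of P Q] by (elim allE[of _ "gcd P Q"]) (rule mp)
  then consider "P dvd gcd P Q" | "is_unit (gcd P Q)" by blast
  then show False
  proof cases
    case 1
    then have "P dvd Q" using gcd_dvd2[of P Q] by (rule dvd_trans)
    then show False using assms(2,3) dvd_imp_degree_le[of P Q] by linarith
  next
    case 2
    then show False using deg by (metis poly_dvd_1)
  qed
qed

text \<open>Lagrange's bound modulo \<open>p\<close>: with more than \<open>degree P\<close> roots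
  as nodes, all Newton coefficients of \<open>P\<close>, and so \<open>P\<close> itself, would be
  divisible by \<open>p\<close>.\<close>

lemma card_roots_mod_le_degree:
  fixes P :: "int poly" and p :: int
  assumes p: "prime p" and ndvd: "\<not> [:p:] dvd P"
    and inj: "\<And>i j. i < j \<Longrightarrow> j < k \<Longrightarrow> \<not> p dvd r j - r i"
    and root: "\<And>j. j < k \<Longrightarrow> p dvd poly P (r j)"
  shows "k \<le> Polynomial.degree P"
proof (rule ccontr)
  assume "\<not> ?thesis"
  then have lt: "Polynomial.degree P < k" by simp
  then have "\<exists>c. P = (\<Sum>l<k. Polynomial.smult (c l) (newton_poly r l))"
    by (intro newton_poly_expansion coeff_eq_0) auto
  then obtain c where c: "P = (\<Sum>l<k. Polynomial.smult (c l) (newton_poly r l))" by blast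
  have "p dvd c l" if "l < k" for l
    by (rule prime_dvd_newton_coeffs[where r = r and k = k and N = k, OF p order.refl inj])
      (use root that c in auto)
  then have "[:p:] dvd Polynomial.smult (c l) (newton_poly r l)" if "l < k" for l
    using that by (simp add: const_poly_dvd_iff)
  then have "[:p:] dvd P" unfolding c by (intro dvd_sum) auto
  with ndvd show False by simp
qed

subsection \<open>Prime sums\<close>

lemma prod_dvd_of_pairwise_coprime:
  fixes f :: "'b \<Rightarrow> 'a :: semiring_gcd"
  assumes "finite A" "\<And>a b. a \<in> A \<Longrightarrow> b \<in> A \<Longrightarrow> a \<noteq> b \<Longrightarrow> coprime (f a) (f b)"
    and "\<And>a. a \<in> A \<Longrightarrow> f a dvd m"
  shows "prod f A dvd m"
  using assms
proof (induction A rule: finite_induct)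
  case (insert a A)
  have "coprime (f a) (prod f A)"
    using insert.hyps insert.prems(1) by (intro prod_coprime_right) auto
  then show ?case using insert by (simp add: divides_mult)
qed auto

text \<open>The two equal middle coefficients together are at most the row sum
  \<open>2 ^ (2 * m + 1)\<close>.\<close>

lemma odd_binomial_le: "(2 * m + 1) choose m \<le> 4 ^ m"
proof -
  have "2 * ((2 * m + 1) choose m) = ((2 * m + 1) choose m) + ((2 * m + 1) choose (m + 1))"
    using binomial_symmetric[of m "2 * m + 1"] by simp
  also have "\<dots> = (\<Sum>k\<in>{m, m + 1}. (2 * m + 1) choose k)" by simp
  also have "\<dots> \<le> (\<Sum>k\<le>2 * m + 1. (2 * m + 1) choose k)" by (intro sum_mono2) auto
  also have "\<dots> = 2 * 4 ^ m" by (simp only: choose_row_sum) (simp add: power_mult)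
  finally show ?thesis by simp
qed

lemma finite_primes_le [simp]: "finite {p :: nat. prime p \<and> p \<le> n}"
  by (rule finite_subset[of _ "{..n}"]) auto

text \<open>Erdos's argument: for \<open>n = 2 * m + 1\<close> the primes above \<open>m + 1\<close>
  divide the binomial coefficient bounded by \<open>4 ^ m\<close>, and induction handles those up to
  \<open>m + 1\<close>. An even \<open>n > 2\<close> is not prime, so it adds nothing to the product
  for \<open>n - 1\<close>.\<close>

lemma primorial_le: "(\<Prod>p | prime p \<and> p \<le> n. p) \<le> (4 :: nat) ^ n"
proof (induction n rule: less_induct)
  case (less n)
  consider "n \<le> 1" | "n = 2" | "n > 2" "even n" | m where "n = 2 * m + 1" "m \<ge> 1"
  proof -
    have "n \<le> 1 \<or> n = 2 \<or> n > 2 \<and> even n \<or> n > 2 \<and> odd n" by arith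
    moreover have "\<exists>m\<ge>1. n = 2 * m + 1" if "n > 2" "odd n"
      using that by (intro exI[of _ "n div 2"]) (auto simp: odd_two_times_div_two_succ)
    ultimately show ?thesis using that by (elim disjE conjE exE) metis+
  qed
  then show ?case
  proof cases
    case 1
    have "n < p" if "prime p" for p using 1 prime_ge_2_nat[OF that] by linarith
    then have "{p. prime p \<and> p \<le> n} = {}" by (auto simp: not_le)
    then show ?thesis by (simp only:) simp
  next
    case 2
    have "p = 2" if "prime p" "p \<le> 2" for p :: nat
      using prime_ge_2_nat[OF that(1)] that(2) by linarith
    then have "{p. prime p \<and> p \<le> n} = {2}" using 2 by auto
    then show ?thesis using 2 by (simp only:) simp
  next
    case 3
    have "p \<le> n \<longleftrightarrow> p \<le> n - 1" if "prime p" for p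
    proof -
      have "p \<noteq> n" using that 3 prime_odd_nat[of n] by auto
      then show ?thesis by linarith
    qed
    then have "{p. prime p \<and> p \<le> n} = {p. prime p \<and> p \<le> n - 1}" by blast
    then have "(\<Prod>p | prime p \<and> p \<le> n. p) \<le> 4 ^ (n - 1)" using less.IH[of "n - 1"] 3 by simp
    also have "\<dots> \<le> 4 ^ n" by (rule power_increasing) auto
    finally show ?thesis .
  next
    case 4
    let ?A = "{p. prime p \<and> p \<le> m + 1}" and ?B = "{p. prime p \<and> m + 1 < p \<and> p \<le> 2 * m + 1}"
    have fin: "finite ?A" "finite ?B" by (auto intro: finite_subset[of _ "{..2 * m + 1}"])
    have "p dvd ((2 * m + 1) choose m)" if "p \<in> ?B" for p
    proof -
      have "p dvd fact (2 * m + 1)" using that by (simp add: prime_dvd_fact_iff del: fact_Suc)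
      also have "fact (2 * m + 1) = fact m * fact (m + 1) * ((2 * m + 1) choose m)"
        using binomial_fact_lemma[of m "2 * m + 1"] by (simp add: mult_2 del: fact_Suc)
      finally have "p dvd fact m * fact (m + 1) * ((2 * m + 1) choose m)" .
      moreover have "\<not> p dvd fact m" "\<not> p dvd fact (m + 1)"
        using that by (simp_all add: prime_dvd_fact_iff del: fact_Suc)
      ultimately show ?thesis using that prime_dvd_multD by blast
    qed
    then have "\<Prod>?B dvd ((2 * m + 1) choose m)"
      by (intro prod_dvd_of_pairwise_coprime fin) (auto intro: primes_coprime)
    then have "\<Prod>?B \<le> (2 * m + 1) choose m" by (rule dvd_imp_le) simp
    then have "\<Prod>?B \<le> 4 ^ m" using odd_binomial_le[of m] by (rule order.trans)
    moreover have "\<Prod>?A \<le> 4 ^ (m + 1)" using less.IH[of "m + 1"] 4 by simp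
    moreover have "{p. prime p \<and> p \<le> n} = ?A \<union> ?B" using 4 by auto
    moreover have "\<Prod>(?A \<union> ?B) = \<Prod>?A * \<Prod>?B" using fin by (intro prod.union_disjoint) auto
    ultimately have "(\<Prod>p | prime p \<and> p \<le> n. p) \<le> 4 ^ (m + 1) * 4 ^ m"
      using mult_mono[of "\<Prod>?A" "4 ^ (m + 1)" "\<Prod>?B" "4 ^ m"] by (simp only:)
    also have "\<dots> = 4 ^ n" using 4 by (simp add: power_add mult_2)
    finally show ?thesis .
  qed
qed

lemma sum_ln_primes_le: "(\<Sum>p | prime p \<and> p \<le> n. ln (real p)) \<le> real n * ln 4"
proof -
  have "(\<Sum>p | prime p \<and> p \<le> n. ln (real p)) = ln (\<Prod>p | prime p \<and> p \<le> n. real p)"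
    by (subst ln_prod) (auto simp: prime_gt_0_nat)
  also have "\<dots> = ln (real (\<Prod>p | prime p \<and> p \<le> n. p))" by simp
  also have "\<dots> \<le> ln (real (4 ^ n))"
  proof -
    have "0 < (\<Prod>p | prime p \<and> p \<le> n. p)" by (intro prod_pos) (auto simp: prime_gt_0_nat)
    then show ?thesis using primorial_le[of n] by (subst ln_le_cancel_iff) (simp_all del: of_nat_prod of_nat_power)
  qed
  also have "\<dots> = real n * ln 4" by (simp add: ln_realpow)
  finally show ?thesis .
qed

section \<open>Collision counting and partial summation\<close>

text \<open>Colliding pairs are counted by the sum of the squared fibre sizes, which is least when
  all fibres are equally large.\<close>

lemma card_collisions_ge:
  fixes h :: "'a \<Rightarrow> nat"
  assumes fin: "finite A" and h: "\<And>a. a \<in> A \<Longrightarrow> h a < m" and m: "0 < m"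
  shows "(real (card A))\<^sup>2 / real m \<le> real (card {(a, b) \<in> A \<times> A. h a = h b})"
proof -
  define c where "c v = card {a \<in> A. h a = v}" for v
  have A: "A = (\<Union>v<m. {a \<in> A. h a = v})" using h by auto
  have "card A = (\<Sum>v<m. c v)"
    unfolding c_def by (subst A, subst card_UN_disjoint) (use fin in auto)
  then have sum: "(\<Sum>v<m. real (c v)) = real (card A)" by simp
  have "{(a, b) \<in> A \<times> A. h a = h b} = (\<Union>v<m. {a \<in> A. h a = v} \<times> {a \<in> A. h a = v})"
    using h by auto
  then have "card {(a, b) \<in> A \<times> A. h a = h b} = card (\<Union>v<m. {a \<in> A. h a = v} \<times> {a \<in> A. h a = v})"
    by simp
  also have "\<dots> = (\<Sum>v<m. c v * c v)"
    unfolding c_def by (subst card_UN_disjoint) (use fin in \<open>auto simp: card_cartesian_product\<close>)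
  finally have sq: "real (card {(a, b) \<in> A \<times> A. h a = h b}) = (\<Sum>v<m. (real (c v))\<^sup>2)"
    by (simp add: power2_eq_square)
  \<comment> \<open>The mean fibre size; Cauchy-Schwarz is used as non-negativity of the variance
    about it.\<close>
  define t where "t = real (card A) / real m"
  have "0 \<le> (\<Sum>v<m. (real (c v) - t)\<^sup>2)" by (intro sum_nonneg) auto
  also have "\<dots> = (\<Sum>v<m. (real (c v))\<^sup>2) - 2 * t * (\<Sum>v<m. real (c v)) + real m * t\<^sup>2"
    by (simp add: power2_diff sum.distrib sum_subtractf sum_distrib_left algebra_simps)
  also have "\<dots> = (\<Sum>v<m. (real (c v))\<^sup>2) - (real (card A))\<^sup>2 / real m"
    unfolding sum using m by (simp add: t_def field_simps power2_eq_square)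
  finally show ?thesis using sq by simp
qed

lemma sum_over_ln_le:
  fixes a :: "nat \<Rightarrow> real"
  assumes S: "\<And>n. 2 \<le> n \<Longrightarrow> (\<Sum>k=2..n. a k) \<le> ln (real n) + C" and N: "2 \<le> N"
  shows "(\<Sum>k=2..N. a k / ln (real k)) \<le> ln (ln (real N)) + (1 - ln (ln 2) + C / ln 2)"
proof -
  \<comment> \<open>Abel summation as an induction: once the boundary term is subtracted, passing
    from \<open>n\<close> to \<open>n + 1\<close> adds only the partial sum up to \<open>n\<close>
    times the drop of \<open>1 / ln\<close>.\<close>
  have "(\<Sum>k=2..N. a k / ln (real k)) - (\<Sum>k=2..N. a k) / ln (real N)
      \<le> ln (ln (real N)) - ln (ln 2) + C * (1 / ln 2 - 1 / ln (real N))"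
    using N
  proof (induction N rule: dec_induct)
    case base
    then show ?case by simp
  next
    case (step n)
    define L where "L = ln (real n)"
    define M where "M = ln (real (Suc n))"
    have LM: "0 < L" "L < M" using step by (auto simp: L_def M_def)
    \<comment> \<open>This comparison makes the main term telescope to
      \<open>ln (ln N)\<close>.\<close>
    have "1 - L / M \<le> ln M - ln L"
      using ln_le_minus_one[of "L / M"] LM by (simp add: ln_div)
    moreover have "(\<Sum>k=2..n. a k) * (1 / L - 1 / M) \<le> (L + C) * (1 / L - 1 / M)"
      using S[of n] step LM by (intro mult_right_mono) (auto simp: L_def frac_le)
    moreover have "(L + C) * (1 / L - 1 / M) = (1 - L / M) + C * (1 / L - 1 / M)"
      using LM by (simp add: field_simps)
    moreover have "(\<Sum>k=2..Suc n. a k / ln (real k)) - (\<Sum>k=2..Suc n. a k) / M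
        = (\<Sum>k=2..n. a k / ln (real k)) - (\<Sum>k=2..n. a k) / L + (\<Sum>k=2..n. a k) * (1 / L - 1 / M)"
      using step by (simp add: L_def M_def algebra_simps add_divide_distrib)
    ultimately show ?case using step.IH
      unfolding L_def[symmetric] M_def[symmetric] by (simp add: algebra_simps)
  qed
  moreover have "(\<Sum>k=2..N. a k) / ln (real N) \<le> 1 + C / ln (real N)"
    using S[OF N] N by (simp add: field_simps)
  ultimately show ?thesis by (simp add: algebra_simps)
qed

subsection \<open>The number of roots modulo a prime on average\<close>

definition roots_mod :: "int poly \<Rightarrow> nat \<Rightarrow> nat set" where
  "roots_mod P p = {r. r < p \<and> int p dvd poly P (int r)}"

lemma finite_roots_mod [simp]: "finite (roots_mod P p)"
  by (rule finite_subset[of _ "{..<p}"]) (auto simp: roots_mod_def)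

text \<open>Converts a set of residues into a sequence of pairwise incongruent integers, the form of
  nodes that the Newton basis needs.\<close>

lemma enum_residues:
  fixes S :: "nat set"
  assumes "S \<subseteq> {..<p}"
  obtains r :: "nat \<Rightarrow> int" where "\<And>i. i < card S \<Longrightarrow> \<exists>s\<in>S. r i = int s"
    and "\<And>i j. i < j \<Longrightarrow> j < card S \<Longrightarrow> \<not> int p dvd r j - r i"
proof -
  have "finite S" using assms finite_subset by blast
  from ex_bij_betw_nat_finite[OF this] obtain h where h: "bij_betw h {0..<card S} S" by blast
  show ?thesis
  proof (rule that[of "\<lambda>i. int (h i)"])
    fix i assume "i < card S"
    then show "\<exists>s\<in>S. int (h i) = int s" using bij_betwE[OF h] by auto
  next
    fix i j assume ij: "i < j" "j < card S"
    then have "h i \<noteq> h j" using bij_betw_imp_inj_on[OF h] by (auto dest: inj_onD)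
    moreover have "h i < p" "h j < p" using bij_betwE[OF h] ij assms by auto
    ultimately have "int (h j) mod int p \<noteq> int (h i) mod int p" by simp
    then show "\<not> int p dvd int (h j) - int (h i)" by (simp add: mod_eq_dvd_iff)
  qed
qed

text \<open>Irreducibility in the integer polynomial ring, at positive degree, includes primitivity:
  a constant divisor must be a unit, since \<open>P\<close> cannot divide a nonzero
  constant.\<close>

lemma irreducible_not_prime_const_dvd:
  fixes P :: "int poly"
  assumes irr: "Factorial_Ring.irreducible P" and deg: "0 < Polynomial.degree P"
    and p: "prime (p :: int)"
  shows "\<not> [:p:] dvd P"
proof
  assume dvd: "[:p:] dvd P"
  have "\<forall>b. b dvd P \<longrightarrow> P dvd b \<or> is_unit b"
    using irr unfolding irreducible_altdef by (elim conjE)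
  then consider "P dvd [:p:]" | "is_unit [:p:]" using dvd by blast
  then show False
  proof cases
    case 1
    have "[:p:] \<noteq> 0" using p by auto
    with 1 show False using dvd_imp_degree_le[of P "[:p:]"] deg by simp
  next
    case 2
    then show False using prime_ge_2_int[OF p] by (simp add: is_unit_const_poly_iff)
  qed
qed

lemma card_roots_mod_le:
  assumes irr: "Factorial_Ring.irreducible P" and deg: "0 < Polynomial.degree P" and p: "prime p"
  shows "card (roots_mod P p) \<le> Polynomial.degree P"
proof -
  have p': "prime (int p)" using p by simp
  have "roots_mod P p \<subseteq> {..<p}" by (auto simp: roots_mod_def)
  from enum_residues[OF this] obtain r :: "nat \<Rightarrow> int" where
    r: "\<And>i. i < card (roots_mod P p) \<Longrightarrow> \<exists>s\<in>roots_mod P p. r i = int s"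
    "\<And>i j. i < j \<Longrightarrow> j < card (roots_mod P p) \<Longrightarrow> \<not> int p dvd r j - r i" by blast
  have "int p dvd poly P (r i)" if "i < card (roots_mod P p)" for i
    using r(1)[OF that] by (auto simp: roots_mod_def)
  with card_roots_mod_le_degree[OF p' irreducible_not_prime_const_dvd[OF irr deg p'], of _ r] r(2)
  show ?thesis by blast
qed

lemma common_roots_dvd_resultant:
  assumes irr: "Factorial_Ring.irreducible P" and deg: "0 < Polynomial.degree P" and p: "prime p"
  shows "int p ^ card (roots_mod P p \<inter> roots_mod Q p) dvd resultant P Q"
proof -
  let ?S = "roots_mod P p \<inter> roots_mod Q p"
  have p': "prime (int p)" using p by simp
  have "?S \<subseteq> {..<p}" by (auto simp: roots_mod_def)
  from enum_residues[OF this] obtain r :: "nat \<Rightarrow> int" where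
    r: "\<And>i. i < card ?S \<Longrightarrow> \<exists>s\<in>?S. r i = int s"
    "\<And>i j. i < j \<Longrightarrow> j < card ?S \<Longrightarrow> \<not> int p dvd r j - r i" by blast
  have "card ?S \<le> card (roots_mod P p)" by (intro card_mono) auto
  also have "\<dots> \<le> Polynomial.degree P" by (rule card_roots_mod_le) fact+
  finally have k: "card ?S \<le> Polynomial.degree P + Polynomial.degree Q" by simp
  show ?thesis
  proof (rule prime_power_dvd_resultant[OF p' k r(2)])
    fix j assume "j < card ?S"
    from r(1)[OF this] show "int p dvd poly P (r j)" "int p dvd poly Q (r j)"
      by (auto simp: roots_mod_def)
  qed
qed

text \<open>The prime powers dividing the resultant are pairwise coprime, so their product divides
  it, and a nonzero integer bounds its divisors. The bound depends on \<open>Q\<close> only through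
  \<open>B\<close>, so it can be summed over a whole box.\<close>

lemma sum_common_roots_le:
  fixes P Q :: "int poly"
  assumes irr: "Factorial_Ring.irreducible P"
    and Q: "Q \<noteq> 0" "Polynomial.degree Q < Polynomial.degree P"
    and H: "\<And>i. \<bar>Polynomial.coeff P i\<bar> \<le> H" "1 \<le> H"
    and B: "\<And>i. \<bar>Polynomial.coeff Q i\<bar> \<le> int B" "0 < B"
  shows "(\<Sum>p | prime p \<and> p \<le> Y. real (card (roots_mod P p \<inter> roots_mod Q p)) * ln (real p))
    \<le> ln (fact (2 * Polynomial.degree P) * real_of_int H ^ Polynomial.degree P)
      + ln (real (B ^ Polynomial.degree P))"
proof -
  let ?A = "{p :: nat. prime p \<and> p \<le> Y}"
  let ?k = "\<lambda>p. card (roots_mod P p \<inter> roots_mod Q p)"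
  let ?d = "Polynomial.degree P"
  have nz: "resultant P Q \<noteq> 0" by (rule resultant_nonzero) fact+
  have "(\<Prod>p\<in>?A. int p ^ ?k p) dvd resultant P Q"
  proof (rule prod_dvd_of_pairwise_coprime)
    fix p q assume "p \<in> ?A" "q \<in> ?A" "p \<noteq> q"
    then have "coprime p q" by (intro primes_coprime) auto
    then show "coprime (int p ^ ?k p) (int q ^ ?k q)" by simp
  next
    fix p assume "p \<in> ?A"
    then show "int p ^ ?k p dvd resultant P Q"
      using irr Q by (intro common_roots_dvd_resultant) auto
  qed simp
  then have "\<bar>\<Prod>p\<in>?A. int p ^ ?k p\<bar> \<le> \<bar>resultant P Q\<bar>" using nz by (rule dvd_imp_le_int[rotated])
  then have "(\<Prod>p\<in>?A. int p ^ ?k p) \<le> \<bar>resultant P Q\<bar>" by simp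
  also have "\<dots> \<le> fact (2 * ?d) * H ^ ?d * int B ^ ?d"
    using abs_resultant_le[of P H Q "int B"] H B Q by simp
  finally have le: "(\<Prod>p\<in>?A. int p ^ ?k p) \<le> fact (2 * ?d) * H ^ ?d * int B ^ ?d" .
  have "(\<Sum>p\<in>?A. real (?k p) * ln (real p)) = ln (\<Prod>p\<in>?A. real p ^ ?k p)"
    by (subst ln_prod) (auto simp: prime_gt_0_nat ln_realpow)
  also have "\<dots> \<le> ln ((fact (2 * ?d) * real_of_int H ^ ?d) * real (B ^ ?d))"
  proof (rule ln_mono)
    show "0 < (\<Prod>p\<in>?A. real p ^ ?k p)" by (intro prod_pos) (auto simp: prime_gt_0_nat)
    have "(\<Prod>p\<in>?A. real p ^ ?k p) = real_of_int (\<Prod>p\<in>?A. int p ^ ?k p)" by simp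
    also have "\<dots> \<le> real_of_int (fact (2 * ?d) * H ^ ?d * int B ^ ?d)"
      using le by (simp only: of_int_le_iff)
    also have "\<dots> = (fact (2 * ?d) * real_of_int H ^ ?d) * real (B ^ ?d)" by simp
    finally show "(\<Prod>p\<in>?A. real p ^ ?k p) \<le> (fact (2 * ?d) * real_of_int H ^ ?d) * real (B ^ ?d)" .
  qed
  also have "\<dots> = ln (fact (2 * ?d) * real_of_int H ^ ?d) + ln (real (B ^ ?d))"
    using H(2) B(2) by (subst ln_mult) auto
  finally show ?thesis .
qed

section \<open>Averaging over a box of polynomials\<close>

definition box_poly :: "nat \<Rightarrow> (nat \<Rightarrow> nat) \<Rightarrow> int poly" where
  "box_poly d f = (\<Sum>i<d. Polynomial.monom (int (f i)) i)"

lemma coeff_box_poly: "Polynomial.coeff (box_poly d f) i = (if i < d then int (f i) else 0)"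
  by (simp add: box_poly_def coeff_sum if_distrib cong: if_cong)

text \<open>
  Averaging over pairs from the box, rather than over its elements, is what avoids the geometry of
  numbers: for every root modulo \<open>p\<close>, however large \<open>p\<close> is compared with \<open>B\<close>, the pairs whose
  difference has that root make up at least the proportion \<open>1 / p\<close>, by Cauchy--Schwarz.
\<close>

lemma weighted_prime_sum_at_power:
  fixes P :: "int poly"
  defines "d \<equiv> Polynomial.degree P"
  assumes irr: "Factorial_Ring.irreducible P" and deg: "0 < d"
    and H: "\<And>i. \<bar>Polynomial.coeff P i\<bar> \<le> H" "1 \<le> H" and B: "0 < B"
  shows "(\<Sum>p | prime p \<and> p \<le> B ^ d. real (card (roots_mod P p)) * ln (real p) / real p)
    \<le> ln (real (B ^ d)) + (ln (fact (2 * d) * real_of_int H ^ d) + real d * ln 4)"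
proof -
  define F where "F = {..<d} \<rightarrow>\<^sub>E {..<B}"
  define Y where "Y = B ^ d"
  define A where "A = {p :: nat. prime p \<and> p \<le> Y}"
  \<comment> \<open>The diagonal is left out because the difference must be nonzero for its
    resultant with \<open>P\<close> to be nonzero.\<close>
  define D where "D = {(f, g) \<in> F \<times> F. f \<noteq> g}"
  define C where "C = ln (fact (2 * d) * real_of_int H ^ d)"
  define q where "q = (\<lambda>(f, g). box_poly d f - box_poly d g)"
  define w where "w p = card (roots_mod P p)" for p
  have finF: "finite F" unfolding F_def by (intro finite_PiE) auto
  have finD: "finite D" by (rule finite_subset[of _ "F \<times> F"]) (auto simp: D_def finF)
  have finA: "finite A" unfolding A_def by simp
  have Y: "0 < Y" using B by (simp add: Y_def)
  have cardF: "card F = Y" by (simp add: F_def Y_def card_PiE)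
  have C0: "0 \<le> C"
  proof -
    have "1 * 1 \<le> fact (2 * d) * real_of_int H ^ d" using H(2) by (intro mult_mono) auto
    then show ?thesis by (simp add: C_def)
  qed
  have w: "w p \<le> d" if "p \<in> A" for p
    using card_roots_mod_le[of P p] irr deg that by (auto simp: w_def A_def d_def)

  have upper: "(\<Sum>p\<in>A. real (card (roots_mod P p \<inter> roots_mod (q x) p)) * ln (real p)) \<le> C + ln Y"
    if xD: "x \<in> D" for x
  proof -
    obtain f g where x: "x = (f, g)" "f \<in> F" "g \<in> F" "f \<noteq> g" using xD by (auto simp: D_def)
    have cq: "Polynomial.coeff (q x) i = (if i < d then int (f i) - int (g i) else 0)" for i
      by (simp add: q_def x coeff_box_poly)
    obtain i where i: "i < d" "f i \<noteq> g i" using x PiE_ext[of f "{..<d}" "\<lambda>_. {..<B}" g] by (auto simp: F_def)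
    then have "Polynomial.coeff (q x) i \<noteq> 0" by (simp add: cq)
    then have nz: "q x \<noteq> 0" by auto
    have "Polynomial.degree (q x) \<le> d - 1" by (rule degree_le) (auto simp: cq)
    then have degq: "Polynomial.degree (q x) < Polynomial.degree P" using deg by (simp add: d_def)
    have "\<bar>Polynomial.coeff (q x) i\<bar> \<le> int B" for i
    proof (cases "i < d")
      case True
      then have "f i < B" "g i < B" using x by (auto simp: F_def)
      then show ?thesis by (simp add: cq abs_if)
    qed (simp add: cq)
    from sum_common_roots_le[OF irr nz degq H this B, of Y] show ?thesis
      by (simp add: A_def C_def d_def Y_def)
  qed
  have lower: "real Y ^ 2 / real p - real Y \<le> real (card {x \<in> D. r \<in> roots_mod (q x) p})"
    if p: "p \<in> A" and r: "r \<in> roots_mod P p" for p r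
  proof -
    \<comment> \<open>The value at \<open>r\<close> modulo \<open>p\<close>: two box elements
      collide under \<open>h\<close> exactly when their difference has the root \<open>r\<close>.
      The \<open>Y\<close> subtracted in the bound pays for the diagonal pairs.\<close>
    define h where "h f = nat (poly (box_poly d f) (int r) mod int p)" for f
    have p0: "0 < p" using p prime_gt_0_nat by (auto simp: A_def)
    have h: "h f < p" for f using p0 by (simp add: h_def nat_less_iff)
    have eq: "h f = h g \<longleftrightarrow> r \<in> roots_mod (q (f, g)) p" for f g
    proof -
      have "h f = h g \<longleftrightarrow> poly (box_poly d f) (int r) mod int p = poly (box_poly d g) (int r) mod int p"
        using p0 by (simp add: h_def eq_nat_nat_iff)
      also have "\<dots> \<longleftrightarrow> int p dvd poly (q (f, g)) (int r)"
        by (simp add: mod_eq_dvd_iff q_def)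
      also have "\<dots> \<longleftrightarrow> r \<in> roots_mod (q (f, g)) p" using r by (auto simp: roots_mod_def)
      finally show ?thesis .
    qed
    have "{(f, g) \<in> F \<times> F. h f = h g} \<subseteq> {x \<in> D. r \<in> roots_mod (q x) p} \<union> (\<lambda>f. (f, f)) ` F"
      using eq by (auto simp: D_def)
    then have "card {(f, g) \<in> F \<times> F. h f = h g} \<le>
        card ({x \<in> D. r \<in> roots_mod (q x) p} \<union> (\<lambda>f. (f, f)) ` F)"
      using finD finF by (intro card_mono) auto
    also have "\<dots> \<le> card {x \<in> D. r \<in> roots_mod (q x) p} + card ((\<lambda>f. (f, f)) ` F)"
      by (rule card_Un_le)
    also have "card ((\<lambda>f. (f, f)) ` F) \<le> Y" using card_image_le[OF finF] cardF by simp
    finally have "card {(f, g) \<in> F \<times> F. h f = h g} \<le> card {x \<in> D. r \<in> roots_mod (q x) p} + Y"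
      by simp
    moreover have "(real (card F))\<^sup>2 / real p \<le> real (card {(f, g) \<in> F \<times> F. h f = h g})"
      by (rule card_collisions_ge) (use finF h p0 in auto)
    ultimately show ?thesis unfolding cardF by simp
  qed

  \<comment> \<open>Double counting of triples of a prime, a root of \<open>P\<close> modulo it and
    a pair whose difference shares that root, weighted by \<open>ln p\<close>. With prime and root
    fixed, \<open>lower\<close> applies; with the pair fixed, \<open>upper\<close> does.\<close>
  have "(\<Sum>p\<in>A. real (w p) * ln (real p) * ((real Y)\<^sup>2 / real p - real Y))
      = (\<Sum>p\<in>A. \<Sum>r\<in>roots_mod P p. ln (real p) * ((real Y)\<^sup>2 / real p - real Y))"
    by (simp add: w_def mult.assoc)
  also have "\<dots> \<le> (\<Sum>p\<in>A. \<Sum>r\<in>roots_mod P p. ln (real p) * real (card {x \<in> D. r \<in> roots_mod (q x) p}))"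
  proof (intro sum_mono mult_left_mono lower)
    fix p assume "p \<in> A"
    then show "0 \<le> ln (real p)" using prime_gt_0_nat[of p] by (simp add: A_def)
  qed
  also have "\<dots> = (\<Sum>p\<in>A. \<Sum>r\<in>roots_mod P p. \<Sum>x\<in>D. if r \<in> roots_mod (q x) p then ln (real p) else 0)"
    by (intro sum.cong refl) (simp add: sum.If_cases finD Int_def mult.commute)
  also have "\<dots> = (\<Sum>p\<in>A. \<Sum>x\<in>D. \<Sum>r\<in>roots_mod P p. if r \<in> roots_mod (q x) p then ln (real p) else 0)"
    by (intro sum.cong refl sum.swap)
  also have "\<dots> = (\<Sum>x\<in>D. \<Sum>p\<in>A. \<Sum>r\<in>roots_mod P p. if r \<in> roots_mod (q x) p then ln (real p) else 0)"
    by (rule sum.swap)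
  also have "\<dots> = (\<Sum>x\<in>D. \<Sum>p\<in>A. real (card (roots_mod P p \<inter> roots_mod (q x) p)) * ln (real p))"
    by (intro sum.cong refl) (simp add: sum.If_cases Int_def)
  also have "\<dots> \<le> (\<Sum>x\<in>D. C + ln Y)" by (intro sum_mono upper)
  also have "\<dots> = real (card D) * (C + ln Y)" by simp
  also have "\<dots> \<le> (real Y)\<^sup>2 * (C + ln Y)"
  proof (rule mult_right_mono)
    have "card D \<le> card (F \<times> F)" by (rule card_mono) (auto simp: D_def finF)
    then have "card D \<le> Y\<^sup>2" by (simp add: card_cartesian_product cardF power2_eq_square)
    then have "real (card D) \<le> real (Y\<^sup>2)" by (simp only: of_nat_le_iff)
    then show "real (card D) \<le> (real Y)\<^sup>2" by simp
  qed (use C0 Y in simp)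
  finally have main: "(\<Sum>p\<in>A. real (w p) * ln (real p) * ((real Y)\<^sup>2 / real p - real Y))
      \<le> (real Y)\<^sup>2 * (C + ln Y)" .
  \<comment> \<open>The diagonal loss \<open>Y\<close> per root is summed with Chebyshev's bound; it
    totals \<open>Y\<^sup>2\<close> times a constant and disappears into the constant after division
    by \<open>Y\<^sup>2\<close>.\<close>
  have "(\<Sum>p\<in>A. real (w p) * ln (real p)) \<le> (\<Sum>p\<in>A. real d * ln (real p))"
  proof (intro sum_mono mult_right_mono)
    fix p assume "p \<in> A"
    then show "real (w p) \<le> real d" "0 \<le> ln (real p)"
      using w[of p] prime_gt_0_nat[of p] by (simp_all add: A_def)
  qed
  also have "\<dots> \<le> real d * (real Y * ln 4)"
    using sum_ln_primes_le[of Y] by (simp add: A_def sum_distrib_left[symmetric] mult_left_mono)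
  finally have theta: "(\<Sum>p\<in>A. real (w p) * ln (real p)) \<le> real d * (real Y * ln 4)" .
  have "(real Y)\<^sup>2 * (\<Sum>p\<in>A. real (w p) * ln (real p) / real p)
      = (\<Sum>p\<in>A. real (w p) * ln (real p) * ((real Y)\<^sup>2 / real p - real Y))
        + real Y * (\<Sum>p\<in>A. real (w p) * ln (real p))"
    by (simp add: sum_distrib_left sum.distrib[symmetric] algebra_simps)
  also have "\<dots> \<le> (real Y)\<^sup>2 * (C + ln Y) + real Y * (real d * (real Y * ln 4))"
    using main theta by (intro add_mono mult_left_mono) auto
  also have "\<dots> = (real Y)\<^sup>2 * (ln Y + (C + real d * ln 4))"
    by (simp add: power2_eq_square algebra_simps)
  finally have "(\<Sum>p\<in>A. real (w p) * ln (real p) / real p) \<le> ln Y + (C + real d * ln 4)"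
    using Y by (subst (asm) mult_le_cancel_left_pos) auto
  then show ?thesis by (simp only: A_def w_def C_def Y_def)
qed

text \<open>Interpolates between \<open>d\<close>-th powers, \<open>d\<close> being the degree: for
  the least \<open>B\<close> with \<open>n \<le> B ^ d\<close>, also
  \<open>B ^ d \<le> 2 ^ d * n\<close>, which costs only \<open>d * ln 2\<close>.\<close>

lemma weighted_prime_sum_le:
  fixes P :: "int poly"
  assumes irr: "Factorial_Ring.irreducible P" and deg: "0 < Polynomial.degree P"
  obtains C where "\<And>n. 2 \<le> n \<Longrightarrow>
    (\<Sum>p | prime p \<and> p \<le> n. real (card (roots_mod P p)) * ln (real p) / real p) \<le> ln (real n) + C"
proof -
  let ?d = "Polynomial.degree P"
  define H where "H = 1 + (\<Sum>i\<le>?d. \<bar>Polynomial.coeff P i\<bar>)"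
  have H: "\<bar>Polynomial.coeff P i\<bar> \<le> H" for i
  proof (cases "i \<le> ?d")
    case True
    then have "\<bar>Polynomial.coeff P i\<bar> \<le> (\<Sum>i\<le>?d. \<bar>Polynomial.coeff P i\<bar>)"
      by (intro member_le_sum) auto
    then show ?thesis by (simp add: H_def)
  next
    case False
    then show ?thesis by (simp add: H_def coeff_eq_0 sum_nonneg add_nonneg_nonneg)
  qed
  have H1: "1 \<le> H" by (simp add: H_def sum_nonneg)
  define K where "K = ln (fact (2 * ?d) * real_of_int H ^ ?d) + real ?d * ln 4"
  show thesis
  proof (rule that[of "real ?d * ln 2 + K"])
    fix n :: nat assume n: "2 \<le> n"
    define B where "B = (LEAST B. n \<le> B ^ ?d)"
    have "n ^ 1 \<le> n ^ ?d" using n deg by (intro power_increasing) auto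
    then have ex: "n \<le> n ^ ?d" by simp
    have B: "n \<le> B ^ ?d" unfolding B_def by (rule LeastI, rule ex)
    have "1 < B"
    proof (rule ccontr)
      assume "\<not> 1 < B"
      then have "B ^ ?d \<le> 1 ^ ?d" by (intro power_mono) auto
      then show False using B n by simp
    qed
    have "\<not> n \<le> (B - 1) ^ ?d"
      using not_less_Least[of "B - 1" "\<lambda>B. n \<le> B ^ ?d"] \<open>1 < B\<close> unfolding B_def by auto
    then have "(B - 1) ^ ?d \<le> n" by simp
    \<comment> \<open>Since \<open>B \<ge> 2\<close>, doubling \<open>B - 1\<close> reaches
      \<open>B\<close>.\<close>
    have "B ^ ?d \<le> (2 * (B - 1)) ^ ?d" using \<open>1 < B\<close> by (intro power_mono) auto
    also have "\<dots> \<le> 2 ^ ?d * n" using \<open>(B - 1) ^ ?d \<le> n\<close> by (simp add: power_mult_distrib)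
    finally have "real (B ^ ?d) \<le> real (2 ^ ?d * n)" by (simp only: of_nat_le_iff)
    then have "ln (real (B ^ ?d)) \<le> ln (real (2 ^ ?d * n))"
      using \<open>1 < B\<close> by (intro ln_mono) auto
    also have "\<dots> = real ?d * ln 2 + ln (real n)"
      using n by (simp add: ln_mult ln_realpow)
    finally have lnB: "ln (real (B ^ ?d)) \<le> real ?d * ln 2 + ln (real n)" .
    have "(\<Sum>p | prime p \<and> p \<le> n. real (card (roots_mod P p)) * ln (real p) / real p)
        \<le> (\<Sum>p | prime p \<and> p \<le> B ^ ?d. real (card (roots_mod P p)) * ln (real p) / real p)"
      using B by (intro sum_mono2) (auto dest: prime_gt_0_nat)
    also have "\<dots> \<le> ln (real (B ^ ?d)) + K"
      using weighted_prime_sum_at_power[of P H B] irr deg H H1 \<open>1 < B\<close> by (simp add: K_def)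
    finally show "(\<Sum>p | prime p \<and> p \<le> n. real (card (roots_mod P p)) * ln (real p) / real p)
        \<le> ln (real n) + (real ?d * ln 2 + K)" using lnB by simp
  qed
qed

lemma sum_roots_mod_div_prime_le:
  fixes P :: "int poly"
  assumes irr: "Factorial_Ring.irreducible P" and deg: "0 < Polynomial.degree P"
  obtains C where "\<And>n. 2 \<le> n \<Longrightarrow>
    (\<Sum>p | prime p \<and> p \<le> n. real (card (roots_mod P p)) / real p) \<le> ln (ln (real n)) + C"
proof -
  obtain C where C: "\<And>n. 2 \<le> n \<Longrightarrow>
    (\<Sum>p | prime p \<and> p \<le> n. real (card (roots_mod P p)) * ln (real p) / real p) \<le> ln (real n) + C"
    using weighted_prime_sum_le[OF irr deg] by blast
  \<comment> \<open>The prime weights are extended by zero to all integers, the setting of the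
    partial summation.\<close>
  define a where "a k = (if prime k then real (card (roots_mod P k)) * ln (real k) / real k else 0)" for k
  have P: "{k \<in> {2..n}. prime k} = {p. prime p \<and> p \<le> n}" for n :: nat
    by (auto intro: prime_ge_2_nat)
  have sum_a: "(\<Sum>k=2..n. a k) = (\<Sum>p | prime p \<and> p \<le> n. real (card (roots_mod P p)) * ln (real p) / real p)" for n
    unfolding a_def by (subst sum.inter_filter[symmetric], simp, subst P, simp)
  show thesis
  proof (rule that[of "1 - ln (ln 2) + C / ln 2"])
    fix n :: nat assume n: "2 \<le> n"
    have "(\<Sum>p | prime p \<and> p \<le> n. real (card (roots_mod P p)) / real p)
        = (\<Sum>p | prime p \<and> p \<le> n. a p / ln (real p))"
    proof (rule sum.cong)
      fix p :: nat assume "p \<in> {p. prime p \<and> p \<le> n}"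
      then have "prime p" "1 < p" by (auto dest: prime_gt_1_nat)
      then show "real (card (roots_mod P p)) / real p = a p / ln (real p)" by (simp add: a_def)
    qed simp
    also have "\<dots> = (\<Sum>k=2..n. a k / ln (real k))"
      by (intro sum.mono_neutral_left) (auto simp: a_def dest: prime_ge_2_nat)
    also have "\<dots> \<le> ln (ln (real n)) + (1 - ln (ln 2) + C / ln 2)"
      by (rule sum_over_ln_le) (use C n sum_a in auto)
    finally show "(\<Sum>p | prime p \<and> p \<le> n. real (card (roots_mod P p)) / real p)
        \<le> ln (ln (real n)) + (1 - ln (ln 2) + C / ln 2)" .
  qed
qed

subsection \<open>The Galois group\<close>

lemma ring_of_type_algebra_ops:
  "\<zero>\<^bsub>(ring_of_type_algebra :: complex ring)\<^esub> = 0" "\<one>\<^bsub>(ring_of_type_algebra :: complex ring)\<^esub> = 1"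
  "a \<oplus>\<^bsub>(ring_of_type_algebra :: complex ring)\<^esub> b = a + b"
  "a \<otimes>\<^bsub>(ring_of_type_algebra :: complex ring)\<^esub> b = a * b"
  by (simp_all add: ring_of_type_algebra_def)

text \<open>Inverses in the ring record are specified by a description, so they are identified with
  the complex ones through uniqueness.\<close>

lemma a_inv_ring_of_type_algebra:
  "\<ominus>\<^bsub>(ring_of_type_algebra :: complex ring)\<^esub> x = - x"
proof -
  interpret R: field "ring_of_type_algebra :: complex ring" by (rule field_from_type_algebra)
  show ?thesis by (rule R.minus_equality) (simp_all add: ring_of_type_algebra_def)
qed

lemma m_inv_ring_of_type_algebra:
  assumes "x \<noteq> 0"
  shows "inv\<^bsub>(ring_of_type_algebra :: complex ring)\<^esub> x = inverse x"
proof -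
  interpret R: field "ring_of_type_algebra :: complex ring" by (rule field_from_type_algebra)
  show ?thesis
    by (rule R.inv_unique'[symmetric]) (use assms in \<open>simp_all add: ring_of_type_algebra_def\<close>)
qed

lemma carrier_splitting_field:
  "carrier (splitting_field P) = generate_field ring_of_type_algebra (complex_roots P)"
  by (simp add: splitting_field_def)

lemma splitting_field_closed:
  shows "1 \<in> carrier (splitting_field P)"
    and "z \<in> complex_roots P \<Longrightarrow> z \<in> carrier (splitting_field P)"
    and "a \<in> carrier (splitting_field P) \<Longrightarrow> - a \<in> carrier (splitting_field P)"
    and "a \<in> carrier (splitting_field P) \<Longrightarrow> a \<noteq> 0 \<Longrightarrow> inverse a \<in> carrier (splitting_field P)"
    and "a \<in> carrier (splitting_field P) \<Longrightarrow> b \<in> carrier (splitting_field P) \<Longrightarrow>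
      a + b \<in> carrier (splitting_field P)"
    and "a \<in> carrier (splitting_field P) \<Longrightarrow> b \<in> carrier (splitting_field P) \<Longrightarrow>
      a * b \<in> carrier (splitting_field P)"
  using generate_field.intros[where R = "ring_of_type_algebra :: complex ring" and H = "complex_roots P"]
    m_inv_ring_of_type_algebra[of a]
  unfolding carrier_splitting_field a_inv_ring_of_type_algebra ring_of_type_algebra_ops by metis+

lemma splitting_field_0: "0 \<in> carrier (splitting_field P)"
  using splitting_field_closed(5)[OF splitting_field_closed(1) splitting_field_closed(3)[OF splitting_field_closed(1)]]
  by simp

lemma splitting_field_of_int: "of_int k \<in> carrier (splitting_field P)"
proof -
  have nat: "of_nat n \<in> carrier (splitting_field P)" for n
    by (induction n) (simp_all add: splitting_field_0 splitting_field_closed)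
  show ?thesis
    using nat[of "nat k"] splitting_field_closed(3)[OF nat[of "nat (- k)"]]
    by (cases "k \<ge> 0") simp_all
qed

lemma Rats_subset_splitting_field: "\<rat> \<subseteq> carrier (splitting_field P)"
proof
  fix a :: complex assume "a \<in> \<rat>"
  then obtain m n where a: "n > 0" "a = of_int m / of_int n" by (elim Rats_cases')
  then show "a \<in> carrier (splitting_field P)"
    using splitting_field_closed(6)[OF splitting_field_of_int[of m] splitting_field_closed(4)[OF splitting_field_of_int[of n]]]
    by (simp add: divide_inverse)
qed

lemma splitting_field_ops:
  "\<zero>\<^bsub>splitting_field P\<^esub> = 0" "\<one>\<^bsub>splitting_field P\<^esub> = 1"
  "a \<oplus>\<^bsub>splitting_field P\<^esub> b = a + b" "a \<otimes>\<^bsub>splitting_field P\<^esub> b = a * b"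
  by (simp_all add: splitting_field_def ring_of_type_algebra_def)

lemma ring_splitting_field: "ring (splitting_field P)"
proof -
  interpret R: field "ring_of_type_algebra :: complex ring" by (rule field_from_type_algebra)
  have "field (splitting_field P)"
    unfolding splitting_field_def
    by (rule R.generate_field_is_field) (simp add: ring_of_type_algebra_def)
  then show ?thesis by (simp add: field_def domain_def cring_def)
qed

section \<open>The automorphisms and their action on the roots\<close>

lemma carrier_galois_group:
  "carrier (galois_group P) = {\<sigma> \<in> Bij (carrier (splitting_field P)).
     \<sigma> \<in> ring_iso (splitting_field P) (splitting_field P) \<and> (\<forall>a\<in>\<rat>. \<sigma> a = a)}"
  by (simp add: galois_group_def)

context
  fixes P :: "int poly" and \<sigma> :: "complex \<Rightarrow> complex"
  assumes \<sigma>: "\<sigma> \<in> carrier (galois_group P)"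
begin

lemma galois_hom: "\<sigma> \<in> Ring.ring_hom (splitting_field P) (splitting_field P)"
  using \<sigma> by (simp add: carrier_galois_group ring_iso_def)

lemma galois_closed: "a \<in> carrier (splitting_field P) \<Longrightarrow> \<sigma> a \<in> carrier (splitting_field P)"
  using ring_hom_memE(1)[OF galois_hom] .

lemma galois_add:
  "a \<in> carrier (splitting_field P) \<Longrightarrow> b \<in> carrier (splitting_field P) \<Longrightarrow> \<sigma> (a + b) = \<sigma> a + \<sigma> b"
  using ring_hom_memE(3)[OF galois_hom] unfolding splitting_field_ops .

lemma galois_mult:
  "a \<in> carrier (splitting_field P) \<Longrightarrow> b \<in> carrier (splitting_field P) \<Longrightarrow> \<sigma> (a * b) = \<sigma> a * \<sigma> b"
  using ring_hom_memE(2)[OF galois_hom] unfolding splitting_field_ops .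

lemma galois_Rats: "a \<in> \<rat> \<Longrightarrow> \<sigma> a = a"
  using \<sigma> by (simp add: carrier_galois_group)

lemma galois_uminus: "a \<in> carrier (splitting_field P) \<Longrightarrow> \<sigma> (- a) = - \<sigma> a"
  using galois_mult[OF splitting_field_of_int[of "-1"], of a] galois_Rats[of "-1"] by simp

lemma galois_inverse:
  assumes "a \<in> carrier (splitting_field P)" "a \<noteq> 0"
  shows "\<sigma> (inverse a) = inverse (\<sigma> a)"
proof -
  have "\<sigma> (inverse a) * \<sigma> a = 1"
    using galois_mult[OF splitting_field_closed(4)[OF assms] assms(1)] galois_Rats[of 1] assms(2) by simp
  then show ?thesis by (metis inverse_unique mult.commute)
qed

text \<open>Horner induction. Membership is carried along because the homomorphism laws hold only
  inside the splitting field.\<close>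

lemma galois_poly:
  assumes "z \<in> carrier (splitting_field P)"
  shows "poly (map_poly of_int p) z \<in> carrier (splitting_field P) \<and>
    \<sigma> (poly (map_poly of_int p) z) = poly (map_poly of_int p) (\<sigma> z)"
proof (induction p)
  case 0
  then show ?case using galois_Rats[of 0] by (simp add: splitting_field_0)
next
  case (pCons a p)
  then show ?case
    using assms splitting_field_of_int[of a] galois_Rats[of "of_int a"]
    by (simp add: map_poly_pCons splitting_field_closed galois_add galois_mult)
qed

lemma galois_root: "z \<in> complex_roots P \<Longrightarrow> \<sigma> z \<in> complex_roots P"
  using galois_poly[OF splitting_field_closed(2), of z P] galois_Rats[of 0]
  by (simp add: complex_roots_def)

text \<open>\<open>compose\<close> cuts the composite down to the field, which keeps it extensional;
  there it agrees with the plain composite, so the isomorphism property transfers.\<close>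

lemma galois_compose:
  assumes \<tau>: "\<tau> \<in> carrier (galois_group P)"
  shows "compose (carrier (splitting_field P)) \<sigma> \<tau> \<in> carrier (galois_group P)"
proof -
  let ?S = "carrier (splitting_field P)"
  have "\<sigma> \<circ> \<tau> \<in> ring_iso (splitting_field P) (splitting_field P)"
    using \<sigma> \<tau> by (intro ring_iso_set_trans) (auto simp: carrier_galois_group)
  then have "compose ?S \<sigma> \<tau> \<in> ring_iso (splitting_field P) (splitting_field P)"
    by (rule ring.ring_iso_restrict[OF ring_splitting_field]) (simp add: compose_def)
  moreover have "compose ?S \<sigma> \<tau> a = a" if "a \<in> \<rat>" for a
    using that Rats_subset_splitting_field[of P] galois_Rats \<tau>
    by (auto simp: compose_def carrier_galois_group)
  ultimately show ?thesis using \<sigma> \<tau> by (simp add: carrier_galois_group compose_Bij)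
qed

end

text \<open>The roots generate the field, and agreement of two automorphisms passes through every
  generation step.\<close>

lemma galois_ext:
  assumes \<sigma>: "\<sigma> \<in> carrier (galois_group P)" and \<tau>: "\<tau> \<in> carrier (galois_group P)"
    and eq: "\<And>z. z \<in> complex_roots P \<Longrightarrow> \<sigma> z = \<tau> z"
  shows "\<sigma> = \<tau>"
proof (rule extensionalityI[of _ "carrier (splitting_field P)"])
  fix x assume "x \<in> carrier (splitting_field P)"
  then have "x \<in> generate_field ring_of_type_algebra (complex_roots P)"
    by (simp add: carrier_splitting_field)
  then show "\<sigma> x = \<tau> x"
  proof (induction rule: generate_field.induct)
    case one
    then show ?case using galois_Rats[OF \<sigma>, of 1] galois_Rats[OF \<tau>, of 1]
      by (simp add: ring_of_type_algebra_ops)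
  next
    case (incl h)
    then show ?case by (rule eq)
  next
    case (a_inv h)
    then show ?case
      using galois_uminus[OF \<sigma>, of h] galois_uminus[OF \<tau>, of h]
      by (simp add: a_inv_ring_of_type_algebra carrier_splitting_field)
  next
    case (m_inv h)
    then show ?case
      using galois_inverse[OF \<sigma>, of h] galois_inverse[OF \<tau>, of h]
      by (simp add: m_inv_ring_of_type_algebra carrier_splitting_field ring_of_type_algebra_ops)
  next
    case (eng_add h1 h2)
    then show ?case
      using galois_add[OF \<sigma>, of h1 h2] galois_add[OF \<tau>, of h1 h2]
      by (simp add: carrier_splitting_field ring_of_type_algebra_ops)
  next
    case (eng_mult h1 h2)
    then show ?case
      using galois_mult[OF \<sigma>, of h1 h2] galois_mult[OF \<tau>, of h1 h2]
      by (simp add: carrier_splitting_field ring_of_type_algebra_ops)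
  qed
qed (use \<sigma> \<tau> in \<open>auto simp: carrier_galois_group Bij_def\<close>)

lemma galois_id: "(\<lambda>x\<in>carrier (splitting_field P). x) \<in> carrier (galois_group P)"
proof -
  have "(\<lambda>x\<in>carrier (splitting_field P). x) \<in> ring_iso (splitting_field P) (splitting_field P)"
    by (rule ring.ring_iso_restrict[OF ring_splitting_field ring_iso_set_refl]) simp
  then show ?thesis
    using Rats_subset_splitting_field[of P] by (auto simp: carrier_galois_group id_Bij)
qed

lemma complex_roots_bound:
  assumes "P \<noteq> 0"
  shows "finite (complex_roots P)" "card (complex_roots P) \<le> Polynomial.degree P"
proof -
  have nz: "map_poly of_int P \<noteq> (0 :: complex poly)"
    using assms by (simp add: map_poly_eq_0_iff)
  then show "finite (complex_roots P)" unfolding complex_roots_def by (rule poly_roots_finite)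
  have "card (complex_roots P) \<le> Polynomial.degree (map_poly of_int P :: complex poly)"
    unfolding complex_roots_def using nz by (rule card_poly_roots_bound)
  also have "\<dots> \<le> Polynomial.degree P" by (rule degree_map_poly_le)
  finally show "card (complex_roots P) \<le> Polynomial.degree P" .
qed

text \<open>Restriction to the finite set of roots is injective by
  \<open>galois_ext\<close>.\<close>

lemma finite_galois_group:
  assumes "P \<noteq> 0"
  shows "finite (carrier (galois_group P))"
proof (rule inj_on_finite)
  show "inj_on (\<lambda>\<sigma>. restrict \<sigma> (complex_roots P)) (carrier (galois_group P))"
  proof (rule inj_onI)
    fix \<sigma> \<tau>
    assume \<sigma>: "\<sigma> \<in> carrier (galois_group P)" and \<tau>: "\<tau> \<in> carrier (galois_group P)"
      and eq: "restrict \<sigma> (complex_roots P) = restrict \<tau> (complex_roots P)"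
    show "\<sigma> = \<tau>" using galois_ext[OF \<sigma> \<tau>] fun_cong[OF eq] by (metis restrict_apply')
  qed
  show "(\<lambda>\<sigma>. restrict \<sigma> (complex_roots P)) ` carrier (galois_group P)
      \<subseteq> complex_roots P \<rightarrow>\<^sub>E complex_roots P"
    using galois_root by auto
  show "finite (complex_roots P \<rightarrow>\<^sub>E complex_roots P)"
    using complex_roots_bound(1)[OF assms] by (intro finite_PiE)
qed

text \<open>A nonempty fibre over \<open>z\<close> lies in the left coset \<open>\<tau> H\<close> of
  the stabilizer \<open>H\<close> of \<open>y\<close>. Left multiplication by \<open>\<tau>\<close>
  is onto because it is injective on a finite group, and this takes the place of an inverse
  element.\<close>

lemma card_galois_fibre_le:
  assumes P: "P \<noteq> 0" and y: "y \<in> complex_roots P"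
  shows "card {\<sigma> \<in> carrier (galois_group P). \<sigma> y = z}
    \<le> card {\<sigma> \<in> carrier (galois_group P). \<sigma> y = y}"
proof (cases "{\<sigma> \<in> carrier (galois_group P). \<sigma> y = z} = {}")
  case True
  then show ?thesis by (simp only:) simp
next
  case False
  let ?G = "carrier (galois_group P)" and ?S = "carrier (splitting_field P)"
  obtain \<tau> where \<tau>: "\<tau> \<in> ?G" "\<tau> y = z" using False by blast
  have yS: "y \<in> ?S" using y by (rule splitting_field_closed)
  have inj: "inj_on \<tau> ?S" using \<tau>(1) by (auto simp: carrier_galois_group Bij_def bij_betw_def)
  have fin: "finite ?G" by (rule finite_galois_group) fact
  have "inj_on (compose ?S \<tau>) ?G"
  proof (rule inj_onI)
    fix \<rho> \<rho>' assume \<rho>: "\<rho> \<in> ?G" "\<rho>' \<in> ?G" and eq: "compose ?S \<tau> \<rho> = compose ?S \<tau> \<rho>'"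
    show "\<rho> = \<rho>'"
    proof (rule galois_ext[OF \<rho>])
      fix z assume "z \<in> complex_roots P"
      then have z: "z \<in> ?S" by (rule splitting_field_closed)
      then have "\<tau> (\<rho> z) = \<tau> (\<rho>' z)" using fun_cong[OF eq, of z] by (simp add: compose_def)
      then show "\<rho> z = \<rho>' z" using inj galois_closed \<rho> z by (auto dest: inj_onD)
    qed
  qed
  moreover have "compose ?S \<tau> ` ?G \<subseteq> ?G" using galois_compose[OF \<tau>(1)] by blast
  ultimately have surj: "compose ?S \<tau> ` ?G = ?G" using fin by (intro endo_inj_surj)
  have "{\<sigma> \<in> ?G. \<sigma> y = z} \<subseteq> compose ?S \<tau> ` {\<sigma> \<in> ?G. \<sigma> y = y}"
  proof
    fix \<sigma> assume "\<sigma> \<in> {\<sigma> \<in> ?G. \<sigma> y = z}"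
    then have \<sigma>: "\<sigma> \<in> compose ?S \<tau> ` ?G" "\<sigma> y = z" unfolding surj by auto
    then obtain \<rho> where \<rho>: "\<rho> \<in> ?G" "\<sigma> = compose ?S \<tau> \<rho>" by blast
    have "\<tau> (\<rho> y) = \<tau> y" using \<rho> \<sigma> \<tau> yS by (simp add: compose_def)
    then have "\<rho> y = y" using inj galois_closed[OF \<rho>(1) yS] yS by (auto dest: inj_onD)
    then show "\<sigma> \<in> compose ?S \<tau> ` {\<sigma> \<in> ?G. \<sigma> y = y}" using \<rho> by blast
  qed
  then show ?thesis using fin by (intro surj_card_le) auto
qed

text \<open>The orbit-stabilizer inequality: the group splits into fibres over at most
  \<open>degree P\<close> roots, each no larger than the stabilizer of \<open>y\<close>.\<close>

lemma fix_proportion_degree_ge_1: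
  assumes P: "P \<noteq> 0" and y: "y \<in> complex_roots P"
  shows "1 \<le> fix_proportion P y * real (Polynomial.degree P)"
proof -
  let ?G = "carrier (galois_group P)"
  let ?H = "{\<sigma> \<in> ?G. \<sigma> y = y}"
  have fin: "finite ?G" by (rule finite_galois_group) fact
  have pos: "0 < card ?G" using fin galois_id[of P] by (auto simp: card_gt_0_iff)
  have "?G = (\<Union>z\<in>complex_roots P. {\<sigma> \<in> ?G. \<sigma> y = z})" using galois_root y by auto
  then have "card ?G \<le> (\<Sum>z\<in>complex_roots P. card {\<sigma> \<in> ?G. \<sigma> y = z})"
    using card_UN_le[OF complex_roots_bound(1)[OF P], of "\<lambda>z. {\<sigma> \<in> ?G. \<sigma> y = z}"] by simp
  also have "\<dots> \<le> (\<Sum>z\<in>complex_roots P. card ?H)"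
    by (intro sum_mono card_galois_fibre_le P y)
  also have "\<dots> \<le> Polynomial.degree P * card ?H" using complex_roots_bound(2)[OF P] by simp
  finally have "real (card ?G) \<le> real (Polynomial.degree P * card ?H)" by (simp only: of_nat_le_iff)
  then show ?thesis using pos by (simp add: fix_proportion_def field_simps)
qed

subsection \<open>Sieving\<close>

text \<open>The Chinese remainder theorem as independence of conditions modulo \<open>m\<close> and
  modulo \<open>n\<close>.\<close>

lemma card_residues_coprime_mult:
  fixes m n :: nat
  assumes "coprime m n" "0 < m" "0 < n"
  shows "card {k. k < m * n \<and> Q (k mod m) \<and> R (k mod n)} = card {a. a < m \<and> Q a} * card {b. b < n \<and> R b}"
proof -
  have "bij_betw (\<lambda>k. (k mod m, k mod n)) {k. k < m * n \<and> Q (k mod m) \<and> R (k mod n)}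
      ({a. a < m \<and> Q a} \<times> {b. b < n \<and> R b})"
  proof (rule bij_betwI')
    fix k l assume "k \<in> {k. k < m * n \<and> Q (k mod m) \<and> R (k mod n)}"
      "l \<in> {k. k < m * n \<and> Q (k mod m) \<and> R (k mod n)}"
    then show "((k mod m, k mod n) = (l mod m, l mod n)) = (k = l)"
      using binary_chinese_remainder_unique_nat[OF assms(1), of k l] assms
        coprime_cong_mult_nat[of k l m n] by (auto simp: cong_def)
  next
    fix x assume "x \<in> {a. a < m \<and> Q a} \<times> {b. b < n \<and> R b}"
    then obtain a b where x: "x = (a, b)" "a < m" "b < n" "Q a" "R b" by auto
    obtain k where "k < m * n" "[k = a] (mod m)" "[k = b] (mod n)"
      using binary_chinese_remainder_unique_nat[OF assms(1), of a b] assms by blast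
    then show "\<exists>k\<in>{k. k < m * n \<and> Q (k mod m) \<and> R (k mod n)}. x = (k mod m, k mod n)"
      using x by (intro bexI[of _ k]) (auto simp: cong_def)
  qed (use assms in auto)
  from bij_betw_same_card[OF this] show ?thesis by (simp add: card_cartesian_product)
qed

text \<open>Lets the sieve run modulo the product of the prime divisors of an integer and then be
  repeated up to the integer itself.\<close>

lemma card_residues_periodic:
  fixes m :: nat
  assumes "0 < m"
  shows "card {k. k < m * t \<and> Q (k mod m)} = t * card {a. a < m \<and> Q a}"
proof -
  have "bij_betw (\<lambda>k. (k div m, k mod m)) {k. k < m * t \<and> Q (k mod m)} ({..<t} \<times> {a. a < m \<and> Q a})"
  proof (rule bij_betwI')
    fix k l
    show "((k div m, k mod m) = (l div m, l mod m)) = (k = l)"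
      by (metis div_mult_mod_eq prod.inject)
  next
    fix k assume "k \<in> {k. k < m * t \<and> Q (k mod m)}"
    then show "(k div m, k mod m) \<in> {..<t} \<times> {a. a < m \<and> Q a}"
      using assms by (simp add: less_mult_imp_div_less mult.commute)
  next
    fix x assume "x \<in> {..<t} \<times> {a. a < m \<and> Q a}"
    then obtain s a where x: "x = (s, a)" "s < t" "a < m" "Q a" by auto
    have "m * s + a < m * (s + 1)" using x by simp
    also have "\<dots> \<le> m * t" using x by (intro mult_le_mono) auto
    finally show "\<exists>k\<in>{k. k < m * t \<and> Q (k mod m)}. x = (k div m, k mod m)"
      using x by (intro bexI[of _ "m * s + a"]) auto
  qed
  from bij_betw_same_card[OF this] show ?thesis by (simp add: card_cartesian_product)
qed

lemma diff_dvd_poly_diff: "x - y dvd poly p x - poly p y"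
  for x y :: "'a :: comm_ring_1"
proof (induction p)
  case (pCons a p)
  have "poly (pCons a p) x - poly (pCons a p) y = x * (poly p x - poly p y) + (x - y) * poly p y"
    by (simp add: algebra_simps)
  also have "x - y dvd \<dots>" using pCons by (intro dvd_add dvd_mult dvd_triv_left)
  finally show ?case .
qed simp

lemma dvd_poly_mod_iff:
  assumes "p dvd m"
  shows "int p dvd poly P (int (k mod m)) \<longleftrightarrow> int p dvd poly P (int k)"
proof -
  have "int m dvd int (k mod m) - int k"
    by (simp add: zmod_int mod_eq_dvd_iff[symmetric])
  moreover have "int (k mod m) - int k dvd poly P (int (k mod m)) - poly P (int k)"
    by (rule diff_dvd_poly_diff)
  ultimately have "int p dvd poly P (int (k mod m)) - poly P (int k)"
    using assms by (meson dvd_trans of_nat_dvd_iff)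
  then show ?thesis
    using dvd_add_right_iff[of "int p" "poly P (int (k mod m)) - poly P (int k)" "poly P (int k)"] by simp
qed

text \<open>Primes enter one at a time: the conditions at the old primes depend only on the residue
  modulo their product \<open>m\<close>, the new one only on the residue modulo \<open>p\<close>,
  and these moduli are coprime.\<close>

lemma card_sieve_prod:
  assumes "finite S" "\<And>p. p \<in> S \<Longrightarrow> prime p"
  shows "card {k. k < \<Prod>S \<and> (\<forall>p\<in>S. \<not> int p dvd poly P (int k))} = (\<Prod>p\<in>S. p - card (roots_mod P p))"
  using assms
proof (induction S rule: finite_induct)
  case (insert p S)
  define m where "m = \<Prod>S"
  have p: "prime p" and S: "\<And>q. q \<in> S \<Longrightarrow> prime q" using insert.prems by auto
  have m: "0 < m" unfolding m_def using S by (intro prod_pos) (auto simp: prime_gt_0_nat)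
  have "coprime m p" unfolding m_def
    using insert.hyps p S by (intro prod_coprime_left) (auto intro: primes_coprime)
  have dvd: "q dvd m" if "q \<in> S" for q using dvd_prodI[OF insert.hyps(1) that, of "\<lambda>x. x"] by (simp add: m_def)
  have "{b. b < p \<and> \<not> int p dvd poly P (int b)} = {..<p} - roots_mod P p"
    by (auto simp: roots_mod_def)
  moreover have "roots_mod P p \<subseteq> {..<p}" by (auto simp: roots_mod_def)
  ultimately have cp: "card {b. b < p \<and> \<not> int p dvd poly P (int b)} = p - card (roots_mod P p)"
    by (simp add: card_Diff_subset)
  have "{k. k < \<Prod>(insert p S) \<and> (\<forall>q\<in>insert p S. \<not> int q dvd poly P (int k))}
      = {k. k < m * p \<and> (\<forall>q\<in>S. \<not> int q dvd poly P (int (k mod m))) \<and> \<not> int p dvd poly P (int (k mod p))}"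
    using insert.hyps dvd by (auto simp: m_def[symmetric] dvd_poly_mod_iff mult.commute)
  also have "card \<dots> = card {a. a < m \<and> (\<forall>q\<in>S. \<not> int q dvd poly P (int a))} *
      card {b. b < p \<and> \<not> int p dvd poly P (int b)}"
    by (rule card_residues_coprime_mult) (use \<open>coprime m p\<close> m p prime_gt_0_nat in auto)
  also have "\<dots> = (\<Prod>q\<in>insert p S. q - card (roots_mod P q))"
    unfolding cp using insert.IH S insert.hyps by (simp add: m_def mult.commute)
  finally show ?case .
qed auto

lemma card_roots_mod_le_modulus: "card (roots_mod P p) \<le> p"
  using card_mono[of "{..<p}" "roots_mod P p"] by (auto simp: roots_mod_def)

text \<open>The analogue of Euler's product. Coprimality to \<open>n\<close> is decided by the
  residue of \<open>k\<close> modulo the radical of \<open>n\<close>, so the count is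
  \<open>t\<close> copies of the sieve over one period.\<close>

lemma phi_eq_prod:
  assumes n: "0 < n"
  shows "real (phi P n) = real n * (\<Prod>p\<in>prime_factors n. 1 - real (card (roots_mod P p)) / real p)"
proof -
  let ?S = "prime_factors n"
  have pr: "prime p" if "p \<in> ?S" for p using that by auto
  have m0: "0 < \<Prod>?S" using pr by (intro prod_pos) (auto simp: prime_gt_0_nat)
  have "\<Prod>?S dvd n"
    by (rule prod_dvd_of_pairwise_coprime) (auto intro: primes_coprime)
  then obtain t where t: "n = \<Prod>?S * t" by (elim dvdE)
  have iff: "gcd (poly P (int k)) (int n) = 1 \<longleftrightarrow> (\<forall>p\<in>?S. \<not> int p dvd poly P (int (k mod \<Prod>?S)))" for k
  proof -
    have "gcd (poly P (int k)) (int n) = 1 \<longleftrightarrow> (\<forall>p\<in>?S. \<not> int p dvd poly P (int k))"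
    proof
      assume g: "gcd (poly P (int k)) (int n) = 1"
      show "\<forall>p\<in>?S. \<not> int p dvd poly P (int k)"
      proof
        fix p assume p: "p \<in> ?S"
        show "\<not> int p dvd poly P (int k)"
        proof
          assume "int p dvd poly P (int k)"
          moreover have "int p dvd int n" using p by auto
          ultimately have "int p dvd gcd (poly P (int k)) (int n)" by (rule gcd_greatest)
          then show False using g pr[OF p] by auto
        qed
      qed
    next
      assume ndvd: "\<forall>p\<in>?S. \<not> int p dvd poly P (int k)"
      show "gcd (poly P (int k)) (int n) = 1"
      proof (rule ccontr)
        assume ne: "gcd (poly P (int k)) (int n) \<noteq> 1"
        define g where "g = nat (gcd (poly P (int k)) (int n))"
        have g: "int g = gcd (poly P (int k)) (int n)" by (simp add: g_def)
        have "g \<noteq> 1" using ne g by auto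
        then obtain p where p: "prime p" "p dvd g" using prime_factor_nat by blast
        have "int p dvd gcd (poly P (int k)) (int n)" using p(2) g by (metis of_nat_dvd_iff)
        then have "int p dvd poly P (int k)" "int p dvd int n" by auto
        then show False using ndvd p(1) n by (auto simp: prime_factors_dvd)
      qed
    qed
    also have "\<dots> \<longleftrightarrow> (\<forall>p\<in>?S. \<not> int p dvd poly P (int (k mod \<Prod>?S)))"
    proof (intro ball_cong refl)
      fix p assume "p \<in> ?S"
      then have "p dvd \<Prod>?S" using dvd_prodI[of ?S p "\<lambda>x. x"] by simp
      then show "(\<not> int p dvd poly P (int k)) \<longleftrightarrow> (\<not> int p dvd poly P (int (k mod \<Prod>?S)))"
        by (simp only: dvd_poly_mod_iff)
    qed
    finally show ?thesis .
  qed
  have "phi P n = card {k. k < \<Prod>?S * t \<and> (\<forall>p\<in>?S. \<not> int p dvd poly P (int (k mod \<Prod>?S)))}"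
    unfolding phi_def iff using t by (intro arg_cong[of _ _ card]) auto
  also have "\<dots> = t * card {a. a < \<Prod>?S \<and> (\<forall>p\<in>?S. \<not> int p dvd poly P (int a))}"
    by (rule card_residues_periodic[OF m0])
  also have "\<dots> = t * (\<Prod>p\<in>?S. p - card (roots_mod P p))"
    using pr by (subst card_sieve_prod) auto
  finally have "real (phi P n) = real t * (\<Prod>p\<in>?S. real p - real (card (roots_mod P p)))"
    using card_roots_mod_le_modulus by (simp add: of_nat_diff)
  also have "(\<Prod>p\<in>?S. real p - real (card (roots_mod P p)))
      = (\<Prod>p\<in>?S. real p * (1 - real (card (roots_mod P p)) / real p))"
  proof (intro prod.cong refl)
    fix p assume "p \<in> ?S"
    then have "0 < p" using pr prime_gt_0_nat by blast
    then show "real p - real (card (roots_mod P p)) = real p * (1 - real (card (roots_mod P p)) / real p)"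
      by (simp add: field_simps)
  qed
  also have "\<dots> = real (\<Prod>?S) * (\<Prod>p\<in>?S. 1 - real (card (roots_mod P p)) / real p)"
    by (simp add: prod.distrib)
  also have "real t * \<dots> = real (\<Prod>?S * t) * (\<Prod>p\<in>?S. 1 - real (card (roots_mod P p)) / real p)"
    by simp
  finally show ?thesis using t by simp
qed

text \<open>Coprimality to the fixed divisor keeps every Euler factor positive: were all residues
  roots, \<open>p\<close> would divide every value of \<open>P\<close>, hence both
  \<open>value_gcd P\<close> and \<open>n\<close>.\<close>

lemma card_roots_mod_less:
  assumes p: "prime p" "p dvd n" and "gcd (int n) (value_gcd P) = 1"
  shows "card (roots_mod P p) < p"
proof -
  have "\<exists>k. \<not> int p dvd poly P (int k)"
  proof (rule ccontr)
    assume "\<not> ?thesis"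
    then have "int p dvd value_gcd P" unfolding value_gcd_def by (intro Gcd_greatest) auto
    moreover have "int p dvd int n" using p(2) by simp
    ultimately have "int p dvd gcd (int n) (value_gcd P)" by simp
    then show False using assms by auto
  qed
  then obtain k where k: "\<not> int p dvd poly P (int k)" by blast
  have "k mod p < p" using p(1) by (simp add: prime_gt_0_nat)
  moreover have "k mod p \<notin> roots_mod P p" using k by (simp add: roots_mod_def dvd_poly_mod_iff)
  ultimately have "roots_mod P p \<subset> {..<p}" by (auto simp: roots_mod_def)
  then show ?thesis using psubset_card_mono[of "{..<p}" "roots_mod P p"] by simp
qed

section \<open>Estimating the product over the prime divisors\<close>

lemma sum_inverse_squares_le: "(\<Sum>k=2..n. 1 / (real k)\<^sup>2) \<le> 1"
proof -
  \<comment> \<open>The bound is sharpened by \<open>1 / n\<close> so that the induction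
    telescopes.\<close>
  have "(\<Sum>k=2..n. 1 / (real k)\<^sup>2) \<le> 1 - 1 / real n" if "1 \<le> n"
    using that
  proof (induction n rule: dec_induct)
    case (step n)
    have "1 / (real (Suc n))\<^sup>2 \<le> 1 / (real n * real (Suc n))"
      unfolding power2_eq_square using step by (intro frac_le mult_right_mono) auto
    also have "\<dots> = 1 / real n - 1 / real (Suc n)"
      using step by (simp add: field_simps)
    finally have "1 / (real (Suc n))\<^sup>2 \<le> 1 / real n - 1 / real (Suc n)" .
    then show ?case using step by simp
  qed simp
  then show ?thesis by (cases "1 \<le> n") (auto intro: order.trans simp: not_le)
qed

text \<open>For \<open>p > 2 * d\<close> the ratio \<open>w / p\<close> is at most
  \<open>1 / 2\<close>, where \<open>ln (1 - t) \<ge> - t - 2 * t\<^sup>2\<close>. For smaller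
  \<open>p\<close>, integrality gives \<open>1 - w / p \<ge> 1 / p \<ge> 1 / (2 * d)\<close>. The
  exponential stays in both cases so that the factors multiply uniformly.\<close>

lemma one_minus_div_prime_ge:
  fixes d :: nat
  assumes "w \<le> d" "w < p" "0 < d"
  shows "1 - real w / real p \<ge>
    (if p \<le> 2 * d then 1 / (2 * real d) else 1) * exp (- (real w / real p) - 2 * (real d)\<^sup>2 * (1 / (real p)\<^sup>2))"
proof -
  have p: "0 < p" using assms by simp
  show ?thesis
  proof (cases "p \<le> 2 * d")
    case True
    have "0 \<le> real w / real p + 2 * (real d)\<^sup>2 * (1 / (real p)\<^sup>2)" by (intro add_nonneg_nonneg) auto
    then have "exp (- (real w / real p) - 2 * (real d)\<^sup>2 * (1 / (real p)\<^sup>2)) \<le> 1"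
      by (subst exp_le_one_iff) linarith
    then have "1 / (2 * real d) * exp (- (real w / real p) - 2 * (real d)\<^sup>2 * (1 / (real p)\<^sup>2)) \<le> 1 / (2 * real d) * 1"
      by (rule mult_left_mono) simp
    also have "\<dots> \<le> 1 / real p" using True p by (simp add: frac_le)
    also have "\<dots> \<le> 1 - real w / real p"
      using assms(2) p by (simp add: field_simps)
    finally show ?thesis using True by simp
  next
    case False
    define t where "t = real w / real p"
    have t: "0 \<le> t" "t \<le> 1 / 2" "t \<le> real d / real p"
      using False assms p by (auto simp: t_def field_simps)
    have "t\<^sup>2 \<le> (real d / real p)\<^sup>2" using t by (intro power_mono)
    then have "- t - 2 * (real d)\<^sup>2 * (1 / (real p)\<^sup>2) \<le> - t - 2 * t\<^sup>2" by (simp add: power_divide)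
    also have "\<dots> \<le> ln (1 - t)" by (rule ln_one_minus_pos_lower_bound[OF t(1,2)])
    finally have "exp (- t - 2 * (real d)\<^sup>2 * (1 / (real p)\<^sup>2)) \<le> exp (ln (1 - t))" by simp
    also have "\<dots> = 1 - t" using t by simp
    finally show ?thesis using False by (simp add: t_def)
  qed
qed

text \<open>The product of the distinct prime divisors is at least \<open>2\<close> to their number
  and at most \<open>n\<close>.\<close>

lemma card_prime_factors_le:
  assumes "0 < n"
  shows "real (card (prime_factors n)) \<le> ln (real n) / ln 2"
proof -
  have "2 ^ card (prime_factors n) = (\<Prod>p\<in>prime_factors n. 2 :: nat)" by simp
  also have "\<dots> \<le> \<Prod>(prime_factors n)" by (intro prod_mono) (auto intro: prime_ge_2_nat)
  also have "\<Prod>(prime_factors n) dvd n"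
    by (rule prod_dvd_of_pairwise_coprime) (auto intro: primes_coprime)
  then have "\<Prod>(prime_factors n) \<le> n" using assms by (rule dvd_imp_le)
  finally have "real (2 ^ card (prime_factors n)) \<le> real n" by (simp only: of_nat_le_iff)
  then have "ln (real (2 ^ card (prime_factors n))) \<le> ln (real n)" by (intro ln_mono) auto
  then show ?thesis by (simp add: ln_realpow field_simps)
qed

lemma phi_lower_bound:
  assumes irr: "Factorial_Ring.irreducible P" and deg: "0 < Polynomial.degree P"
  obtains c where "0 < c" "\<And>n. exp (exp 1) \<le> real n \<Longrightarrow> gcd (int n) (value_gcd P) = 1 \<Longrightarrow>
    c * real n / ln (ln (real n)) \<le> real (phi P n)"
proof -
  define d where "d = Polynomial.degree P"
  define w where "w p = card (roots_mod P p)" for p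
  obtain C where C: "\<And>n. 2 \<le> n \<Longrightarrow>
    (\<Sum>p | prime p \<and> p \<le> n. real (w p) / real p) \<le> ln (ln (real n)) + C"
    using sum_roots_mod_div_prime_le[OF irr deg] unfolding w_def by blast
  \<comment> \<open>The first factor pays for the at most \<open>2 * d\<close> primes up to
    \<open>2 * d\<close>. In the exponent, \<open>C\<close> comes from the primes up to
    \<open>ln n\<close>, \<open>d / ln 2\<close> from the larger prime divisors, and
    \<open>2 * d\<^sup>2\<close> from the quadratic terms.\<close>
  define c where "c = (1 / (2 * real d)) ^ (2 * d) * exp (- (C + real d / ln 2) - 2 * (real d)\<^sup>2)"
  have d: "0 < d" using deg by (simp add: d_def)
  show thesis
  proof (rule that[of c])
    show "0 < c" using d by (simp add: c_def)
    fix n :: nat assume n: "exp (exp 1) \<le> real n" and gcd: "gcd (int n) (value_gcd P) = 1"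
    have "0 < real n" using n exp_gt_zero[of "exp 1"] by linarith
    then have n0: "0 < n" by simp
    define L where "L = ln (real n)"
    have "ln (exp (exp 1)) \<le> L" unfolding L_def using n by (intro ln_mono) auto
    then have L: "exp 1 \<le> L" by simp
    have L2: "2 \<le> L" using L exp_ge_add_one_self[of 1] by linarith
    let ?S = "prime_factors n"
    define Y where "Y = nat \<lfloor>L\<rfloor>"
    have Y: "2 \<le> Y" "real Y \<le> L" using L2 by (auto simp: Y_def le_nat_iff le_floor_iff)
    have YL: "L \<le> real p" if "Y < p" for p using that L2 unfolding Y_def by linarith
    have pr: "prime p" if "p \<in> ?S" for p using that by auto
    have wd: "w p \<le> d" if "p \<in> ?S" for p
      using card_roots_mod_le[OF irr deg pr[OF that]] by (simp add: w_def d_def)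
    have wp: "w p < p" if "p \<in> ?S" for p
      using card_roots_mod_less[OF pr[OF that] _ gcd] that by (auto simp: w_def)
    \<comment> \<open>Below the cut at \<open>Y\<close>, the floor of \<open>ln n\<close>, the
      divisors of \<open>n\<close> are replaced by all primes, which contributes
      \<open>ln (ln (ln n))\<close> up to a constant.\<close>
    have "(\<Sum>p\<in>?S. real (w p) / real p)
        \<le> (\<Sum>p\<in>{p. prime p \<and> p \<le> Y} \<union> {p \<in> ?S. Y < p}. real (w p) / real p)"
      using pr by (intro sum_mono2) auto
    also have "\<dots> = (\<Sum>p | prime p \<and> p \<le> Y. real (w p) / real p) + (\<Sum>p\<in>{p \<in> ?S. Y < p}. real (w p) / real p)"
      by (intro sum.union_disjoint) auto
    also have "\<dots> \<le> (ln (ln (real Y)) + C) + real d / ln 2"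
    proof (rule add_mono[OF C[OF Y(1)]])
      \<comment> \<open>Above the cut each term is at most \<open>d / L\<close>, and
        \<open>n\<close> has at most \<open>L / ln 2\<close> prime divisors.\<close>
      have "(\<Sum>p\<in>{p \<in> ?S. Y < p}. real (w p) / real p) \<le> (\<Sum>p\<in>{p \<in> ?S. Y < p}. real d / L)"
        using wd YL L2 by (intro sum_mono frac_le) auto
      also have "\<dots> \<le> (\<Sum>p\<in>?S. real d / L)" using L2 by (intro sum_mono2) auto
      also have "\<dots> \<le> (L / ln 2) * (real d / L)"
        using card_prime_factors_le[OF n0] L2 by (simp only: sum_constant) (intro mult_right_mono, auto simp: L_def)
      also have "\<dots> = real d / ln 2" using L2 by simp
      finally show "(\<Sum>p\<in>{p \<in> ?S. Y < p}. real (w p) / real p) \<le> real d / ln 2" .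
    qed
    also have "ln (ln (real Y)) \<le> ln (ln L)"
      using Y by (intro ln_mono) auto
    finally have sumw: "(\<Sum>p\<in>?S. real (w p) / real p) \<le> ln (ln L) + (C + real d / ln 2)" by simp
    have "(\<Sum>p\<in>?S. 1 / (real p)\<^sup>2) \<le> (\<Sum>k=2..n. 1 / (real k)\<^sup>2)"
    proof (rule sum_mono2)
      show "?S \<subseteq> {2..n}"
      proof
        fix p assume p: "p \<in> ?S"
        then have "p dvd n" by auto
        then show "p \<in> {2..n}" using prime_ge_2_nat[OF pr[OF p]] n0 by (auto dest: dvd_imp_le)
      qed
    qed auto
    also note sum_inverse_squares_le
    finally have sumsq: "(\<Sum>p\<in>?S. 1 / (real p)\<^sup>2) \<le> 1" .
    \<comment> \<open>The base is at most one, so overcounting the small primes only lowers the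
      bound.\<close>
    have "(1 / (2 * real d)) ^ (2 * d) \<le> (1 / (2 * real d)) ^ card {p \<in> ?S. p \<le> 2 * d}"
    proof (rule power_decreasing)
      have "card {p \<in> ?S. p \<le> 2 * d} \<le> card {1..2 * d}"
        using pr by (intro card_mono) (auto simp: Suc_le_eq prime_gt_0_nat)
      then show "card {p \<in> ?S. p \<le> 2 * d} \<le> 2 * d" by simp
    qed (use d in auto)
    also have "\<dots> = (\<Prod>p\<in>?S. if p \<le> 2 * d then 1 / (2 * real d) else 1)"
      by (simp add: prod.If_cases Int_def)
    finally have small: "(1 / (2 * real d)) ^ (2 * d) \<le> (\<Prod>p\<in>?S. if p \<le> 2 * d then 1 / (2 * real d) else 1)" .
    have "c / ln L = (1 / (2 * real d)) ^ (2 * d) * exp (- (ln (ln L) + (C + real d / ln 2)) - 2 * (real d)\<^sup>2 * 1)"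
    proof -
      have "1 < L" using L2 by linarith
      then have "exp (- (ln (ln L))) = 1 / ln L" by (simp add: exp_minus inverse_eq_divide)
      moreover have "- (ln (ln L) + (C + real d / ln 2)) - 2 * (real d)\<^sup>2 * 1
          = - (ln (ln L)) + (- (C + real d / ln 2) - 2 * (real d)\<^sup>2)" by simp
      ultimately show ?thesis by (simp only: exp_add c_def) simp
    qed
    also have "\<dots> \<le> (\<Prod>p\<in>?S. if p \<le> 2 * d then 1 / (2 * real d) else 1) *
        exp (- (\<Sum>p\<in>?S. real (w p) / real p) - 2 * (real d)\<^sup>2 * (\<Sum>p\<in>?S. 1 / (real p)\<^sup>2))"
    proof (rule mult_mono[OF small])
      have "2 * (real d)\<^sup>2 * (\<Sum>p\<in>?S. 1 / (real p)\<^sup>2) \<le> 2 * (real d)\<^sup>2 * 1"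
        using sumsq by (intro mult_left_mono) auto
      then show "exp (- (ln (ln L) + (C + real d / ln 2)) - 2 * (real d)\<^sup>2 * 1)
          \<le> exp (- (\<Sum>p\<in>?S. real (w p) / real p) - 2 * (real d)\<^sup>2 * (\<Sum>p\<in>?S. 1 / (real p)\<^sup>2))"
        using sumw by simp
    qed (auto intro: prod_nonneg)
    also have "\<dots> = (\<Prod>p\<in>?S. (if p \<le> 2 * d then 1 / (2 * real d) else 1) *
        exp (- (real (w p) / real p) - 2 * (real d)\<^sup>2 * (1 / (real p)\<^sup>2)))"
      by (simp add: prod.distrib exp_sum[symmetric] sum_subtractf sum_negf sum_distrib_left)
    also have "\<dots> \<le> (\<Prod>p\<in>?S. 1 - real (w p) / real p)"
      using wd wp d by (intro prod_mono conjI one_minus_div_prime_ge) auto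
    finally have "real n * (c / ln L) \<le> real n * (\<Prod>p\<in>?S. 1 - real (w p) / real p)"
      by (intro mult_left_mono) auto
    also have "\<dots> = real (phi P n)" using phi_eq_prod[OF n0, of P] by (simp add: w_def)
    finally show "c * real n / ln (ln (real n)) \<le> real (phi P n)"
      by (simp add: L_def mult.commute)
  qed
qed

section \<open>From exponent minus one to the exponent given by the Galois group\<close>

theorem theorem2p1:
  fixes P :: "int poly" and y :: complex and d :: nat and \<delta> :: int and q :: real
  assumes "Polynomial.degree P > 0"
    and "Factorial_Ring.irreducible P"
    and "d = Polynomial.degree P"
    and "\<delta> = value_gcd P"
    and "y \<in> complex_roots P"
    and "q = fix_proportion P y"
  shows "\<exists>c>0. \<forall>\<epsilon>>0. \<exists>N::nat. \<forall>n::nat. n \<ge> 2 \<longrightarrow> n > N \<longrightarrow> gcd (int n) \<delta> = 1 \<longrightarrow>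
           real (phi P n) \<ge> c * real n * ln (ln (real n)) powr (- (q * real d) - \<epsilon>)"
proof -
  obtain c where c: "0 < c" "\<And>n. exp (exp 1) \<le> real n \<Longrightarrow> gcd (int n) (value_gcd P) = 1 \<Longrightarrow>
    c * real n / ln (ln (real n)) \<le> real (phi P n)"
    using phi_lower_bound[OF assms(2,1)] by blast
  have "P \<noteq> 0" using assms(1) by auto
  then have qd: "1 \<le> q * real d" using fix_proportion_degree_ge_1 assms by blast
  show ?thesis
  \<comment> \<open>The threshold is chosen to make \<open>ln (ln n) \<ge> 1\<close>, so that
    lowering the exponent lowers the power.\<close>
  proof (intro exI[of _ c] conjI allI impI exI[of _ "nat \<lceil>exp (exp 1 :: real)\<rceil>"] c(1))
    fix \<epsilon> :: real and n :: nat
    assume \<epsilon>: "0 < \<epsilon>" and n: "nat \<lceil>exp (exp 1 :: real)\<rceil> < n" and gcd: "gcd (int n) \<delta> = 1"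
    have n': "exp (exp 1) \<le> real n" using n by linarith
    define T where "T = ln (ln (real n))"
    have "exp 1 \<le> ln (real n)"
      using n' by (metis exp_gt_zero ln_exp ln_mono)
    then have T: "1 \<le> T" unfolding T_def by (metis exp_gt_zero ln_exp ln_mono)
    \<comment> \<open>The orbit-stabilizer inequality \<open>1 \<le> q * d\<close> puts the exponent
      below minus one.\<close>
    have "T powr (- (q * real d) - \<epsilon>) \<le> T powr (- 1)"
      using T qd \<epsilon> by (intro powr_mono) auto
    also have "\<dots> = 1 / T" using T by (simp add: powr_minus_divide)
    finally have "c * real n * T powr (- (q * real d) - \<epsilon>) \<le> c * real n * (1 / T)"
      using c(1) by (intro mult_left_mono) auto
    also have "\<dots> \<le> real (phi P n)" using c(2)[OF n'] gcd assms(4) by (simp add: T_def)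
    finally show "real (phi P n) \<ge> c * real n * ln (ln (real n)) powr (- (q * real d) - \<epsilon>)"
      by (simp add: T_def)
  qed
qed

end
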